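(* The algebra $\mathcal U$ has a presentation by generators $$\lbrace W_{-k}\rbrace_{k\in\mathbb N},\qquad \lbrace W_{k+1}\rbrace_{k\in\mathbb N},\qquad \lbrace G_{k+1}\rbrace_{k\in\mathbb N},\qquad \lbrace \tilde G_{k+1}\rbrace_{k\in\mathbb N}$$ (the alternating elements of $\mathcal U$) and the following relations, in which $G_0=1$ and $\tilde G_0=1$. For all $k,\ell\in\mathbb N$: \begin{align*} &\lbrack W_0,W_{k+1}\rbrack=\lbrack W_{-k},W_1\rbrack=(1-q^{-2})(\tilde G_{k+1}-G_{k+1}),\\ &\lbrack W_0,G_{k+1}\rbrack_q=\lbrack \tilde G_{k+1},W_0\rbrack_q=(q-q^{-1})W_{-k-1},\\ &\lbrack G_{k+1},W_1\rbrack_q=\lbrack W_1,\tilde G_{k+1}\rbrack_q=(q-q^{-1})W_{k+2},\\ &\lbrack W_{-k},W_{-\ell}\rbrack=0,\qquad \lbrack W_{k+1},W_{\ell+1}\rbrack=0,\\ &\lbrack W_{-k},W_{\ell+1}\rbrack+\lbrack W_{k+1},W_{-\ell}\rbrack=0,\\ &\lbrack W_{-k},G_{\ell+1}\rbrack+\lbrack G_{k+1},W_{-\ell}\rbrack=0,\\ &\lbrack W_{-k},\tilde G_{\ell+1}\rbrack+\lbrack \tilde G_{k+1},W_{-\ell}\rbrack=0,\\ &\lbrack W_{k+1},G_{\ell+1}\rbrack+\lbrack G_{k+1},W_{\ell+1}\rbrack=0,\\ &\lbrack W_{k+1},\tilde G_{\ell+1}\rbrack+\lbrack \tilde G_{k+1},W_{\ell+1}\rbrack=0,\\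 &\lbrack G_{k+1},G_{\ell+1}\rbrack=0,\qquad \lbrack \tilde G_{k+1},\tilde G_{\ell+1}\rbrack=0,\\ &\lbrack \tilde G_{k+1},G_{\ell+1}\rbrack+\lbrack G_{k+1},\tilde G_{\ell+1}\rbrack=0 \end{align*} and also \begin{align*} &\lbrack W_{-k},G_\ell\rbrack_q=\lbrack W_{-\ell},G_k\rbrack_q,\qquad \lbrack G_k,W_{\ell+1}\rbrack_q=\lbrack G_\ell,W_{k+1}\rbrack_q,\\ &\lbrack \tilde G_k,W_{-\ell}\rbrack_q=\lbrack \tilde G_\ell,W_{-k}\rbrack_q,\qquad \lbrack W_{\ell+1},\tilde G_k\rbrack_q=\lbrack W_{k+1},\tilde G_\ell\rbrack_q,\\ &\lbrack G_k,\tilde G_{\ell+1}\rbrack-\lbrack G_\ell,\tilde G_{k+1}\rbrack=q\lbrack W_{-\ell},W_{k+1}\rbrack_q-q\lbrack W_{-k},W_{\ell+1}\rbrack_q,\\ &\lbrack \tilde G_k,G_{\ell+1}\rbrack-\lbrack \tilde G_\ell,G_{k+1}\rbrack=q\lbrack W_{\ell+1},W_{-k}\rbrack_q-q\lbrack W_{k+1},W_{-\ell}\rbrack_q,\\ &\lbrack G_{k+1},\tilde G_{\ell+1}\rbrack_q-\lbrack G_{\ell+1},\tilde G_{k+1}\rbrack_q=q\lbrack W_{-\ell},W_{k+2}\rbrack-q\lbrack W_{-k},W_{\ell+2}\rbrack,\\ &\lbrack \tilde G_{k+1},G_{\ell+1}\rbrack_q-\lbrack \tilde G_{\ell+1},G_{k+1}\rbrack_q=q\lbrack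 W_{\ell+1},W_{-k-1}\rbrack-q\lbrack W_{k+1},W_{-\ell-1}\rbrack. \end{align*}
   Context: Conventions: $\mathbb N=\{0,1,2,\ldots\}$; $\mathbb F$ is a field; $q\in\mathbb F$ is nonzero and not a root of unity. All algebras are associative, over $\mathbb F$, with a multiplicative identity. For elements $X,Y$ of an algebra, $\lbrack X,Y\rbrack=XY-YX$, $\lbrack X,Y\rbrack_q=qXY-q^{-1}YX$, and $\lbrack X,Y\rbrack_{q^{-1}}=q^{-1}XY-qYX$. The algebra $\mathcal U$ is defined by generators $W_0$, $W_1$, $\lbrace\tilde G_{k+1}\rbrace_{k\in\mathbb N}$ and relations: (i) $\lbrack W_0,\lbrack W_0,\lbrack W_0,W_1\rbrack_q\rbrack_{q^{-1}}\rbrack=0$; (ii) $\lbrack W_1,\lbrack W_1,\lbrack W_1,W_0\rbrack_q\rbrack_{q^{-1}}\rbrack=0$; (iii) $\lbrack\tilde G_1,W_1\rbrack=q\,\dfrac{\lbrack\lbrack W_0,W_1\rbrack_q,W_1\rbrack}{q^2-q^{-2}}$; (iv) $\lbrack W_0,\tilde G_1\rbrack=q\,\dfrac{\lbrack W_0,\lbrack W_0,W_1\rbrack_q\rbrack}{q^2-q^{-2}}$; (v) for $k\ge1$, $\lbrack\tilde G_{k+1},W_1\rbrack=\dfrac{\lbrack\lbrack\lbrack\tilde G_k,W_0\rbrack_q,W_1\rbrack_q,W_1\rbrack}{(1-q^{-2})(q^2-q^{-2})}$; (vi) for $k\ge1$, $\lbrack W_0,\tilde G_{k+1}\rbrack=\dfrac{\lbrack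 W_0,\lbrack W_0,\lbrack W_1,\tilde G_k\rbrack_q\rbrack_q\rbrack}{(1-q^{-2})(q^2-q^{-2})}$; (vii) for $k,\ell\in\mathbb N$, $\lbrack\tilde G_{k+1},\tilde G_{\ell+1}\rbrack=0$. Put $\tilde G_0=1$. In $\mathcal U$ define, for $k\in\mathbb N$, $$W_{-k}=\frac{\lbrack\tilde G_k,W_0\rbrack_q}{q-q^{-1}},\qquad W_{k+1}=\frac{\lbrack W_1,\tilde G_k\rbrack_q}{q-q^{-1}},\qquad G_{k+1}=\tilde G_{k+1}+\frac{\lbrack W_1,W_{-k}\rbrack}{1-q^{-2}},$$ and $G_0=1$ (for $k=0$ the first two formulas return the generators $W_0,W_1$). The elements $W_{-k},W_{k+1},G_{k+1},\tilde G_{k+1}$ $(k\in\mathbb N)$ are called the alternating elements (alternating generators) of $\mathcal U$. *)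

theory Defs
  imports "HOL-Library.Poly_Mapping" "HOL-Algebra.QuotRing" "HOL-Algebra.Module"
begin

section \<open>Free associative algebras\<close>

text \<open>
  The free associative unital algebra on a set of generators is the monoid algebra of the free
  monoid. The free monoid is written additively, so that the convolution product of
  \<open>Poly_Mapping\<close> applies. A separate type of words is used in order not to give \<open>list\<close> a global
  \<open>+\<close>.
\<close>

datatype 'a word = Word (letters: "'a list")

instantiation word :: (type) monoid_add
begin

definition zero_word :: "'a word" where
  "0 = Word []"

definition plus_word :: "'a word \<Rightarrow> 'a word \<Rightarrow> 'a word" where
  "u + v = Word (letters u @ letters v)"

instance
  by standard (simp_all add: zero_word_def plus_word_def)

end

type_synonym ('g, 'f) falg = "'g word \<Rightarrow>\<^sub>0 'f"

text \<open>
  Algebras over the field \<open>'f\<close> are records of type \<open>module\<close>, i.e. rings (not necessarily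
  commutative) with a scalar multiplication. The locale \<open>algebra\<close> of HOL-Algebra is not used, as
  it requires a commutative multiplication.
\<close>

definition free_alg :: "('f::field, ('g, 'f) falg) module" where
  "free_alg = \<lparr>carrier = UNIV, mult = (*), one = 1, zero = 0, add = (+),
               smult = (\<lambda>c p. Poly_Mapping.single 0 c * p)\<rparr>"

definition gen :: "'g \<Rightarrow> ('g, 'f::field) falg" where
  "gen x = Poly_Mapping.single (Word [x]) 1"

definition alg_hom ::
    "('f, 'a, 'm) module_scheme \<Rightarrow> ('f, 'b, 'n) module_scheme \<Rightarrow> ('a \<Rightarrow> 'b) set" where
  "alg_hom A B = {h \<in> ring_hom A B.
      \<forall>c. \<forall>x\<in>carrier A. h (c \<odot>\<^bsub>A\<^esub> x) = c \<odot>\<^bsub>B\<^esub> h x}"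


section \<open>Presentations by generators and relations\<close>

text \<open>
  A relation \<open>u = v\<close> is the pair \<open>(u, v)\<close> of elements of the free algebra. The ideals of
  HOL-Algebra are two-sided; every ideal of \<open>free_alg\<close> is a subspace, because
  \<open>c \<odot> p = (c \<odot> 1) \<otimes> p\<close>.
\<close>

definition rel_ideal ::
    "(('g, 'f::field) falg \<times> ('g, 'f) falg) set \<Rightarrow> ('g, 'f) falg set" where
  "rel_ideal R = Idl\<^bsub>free_alg\<^esub> {u \<ominus>\<^bsub>free_alg\<^esub> v | u v. (u, v) \<in> R}"

definition quot_alg :: "('f, 'a, 'm) module_scheme \<Rightarrow> 'a set \<Rightarrow> ('f, 'a set) module" where
  "quot_alg A I = ring.extend (A Quot I)
     (module.fields (\<lambda>c X. \<Union>x\<in>X. I +>\<^bsub>A\<^esub> (c \<odot>\<^bsub>A\<^esub> x)))"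

definition presented_alg ::
    "(('g, 'f::field) falg \<times> ('g, 'f) falg) set \<Rightarrow> ('f, ('g, 'f) falg set) module" where
  "presented_alg R = quot_alg free_alg (rel_ideal R)"

definition presented_gen ::
    "(('g, 'f::field) falg \<times> ('g, 'f) falg) set \<Rightarrow> 'g \<Rightarrow> ('g, 'f) falg set" where
  "presented_gen R x = rel_ideal R +>\<^bsub>free_alg\<^esub> gen x"

text \<open>
  \<open>A\<close> has a presentation by the generators \<open>a x\<close> (one for each \<open>x :: 'g\<close>) and relations \<open>R\<close>:
  the algebra homomorphism from the free algebra sending each \<open>x\<close> to \<open>a x\<close> is onto, and its
  kernel is the two-sided ideal generated by \<open>R\<close>.
\<close>

definition has_presentation ::
    "('f::field, 'a, 'm) module_scheme \<Rightarrow> ('g \<Rightarrow> 'a)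
      \<Rightarrow> (('g, 'f) falg \<times> ('g, 'f) falg) set \<Rightarrow> bool" where
  "has_presentation A a R \<longleftrightarrow>
     (\<exists>h \<in> alg_hom free_alg A.
        (\<forall>x. h (gen x) = a x) \<and>
        h ` carrier free_alg = carrier A \<and>
        a_kernel free_alg A h = rel_ideal R)"

lemma ring_free_alg: "ring (free_alg :: ('f::field, ('g, 'f) falg) module)"
proof (rule ringI)
  show "abelian_group (free_alg :: ('f, ('g, 'f) falg) module)"
  proof (rule abelian_groupI)
    fix x :: "('g, 'f) falg"
    show "\<exists>y\<in>carrier free_alg. y \<oplus>\<^bsub>free_alg\<^esub> x = \<zero>\<^bsub>free_alg\<^esub>"
      by (intro bexI[of _ "- x"]) (simp_all add: free_alg_def)
  qed (simp_all add: free_alg_def algebra_simps)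
  show "monoid (free_alg :: ('f, ('g, 'f) falg) module)"
    by (rule monoidI) (simp_all add: free_alg_def algebra_simps)
qed (simp_all add: free_alg_def algebra_simps)

lemma ideal_rel_ideal: "ideal (rel_ideal R) free_alg"
  unfolding rel_ideal_def
  by (rule ring.genideal_ideal[OF ring_free_alg]) (simp add: free_alg_def)

lemma presented_alg_has_presentation:
  "has_presentation (presented_alg R) (presented_gen R) R"
proof -
  let ?F = "free_alg :: ('b, ('a, 'b) falg) module"
  let ?I = "rel_ideal R"
  let ?h = "\<lambda>x. ?I +>\<^bsub>?F\<^esub> x"
  interpret ideal ?I ?F by (rule ideal_rel_ideal)
  have Q: "presented_alg R = \<lparr>carrier = carrier (?F Quot ?I), mult = mult (?F Quot ?I),
      one = one (?F Quot ?I), zero = zero (?F Quot ?I), add = add (?F Quot ?I),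
      smult = (\<lambda>c X. \<Union>x\<in>X. ?I +>\<^bsub>?F\<^esub> (c \<odot>\<^bsub>?F\<^esub> x))\<rparr>"
    by (simp add: presented_alg_def quot_alg_def ring.defs module.defs FactRing_def)
  have U: "x \<in> carrier ?F" for x by (simp add: free_alg_def)
  have sm: "(\<Union>y\<in>?h x. ?h (c \<odot>\<^bsub>?F\<^esub> y)) = ?h (c \<odot>\<^bsub>?F\<^esub> x)" for c x
  proof -
    have "?h (c \<odot>\<^bsub>?F\<^esub> y) = ?h (c \<odot>\<^bsub>?F\<^esub> x)" if y: "y \<in> ?h x" for y
    proof -
      obtain i where i: "i \<in> ?I" "y = i + x"
        using y by (auto simp: a_r_coset_def' free_alg_def)
      have ci: "Poly_Mapping.single 0 c * i \<in> ?I"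
        using I_l_closed[OF i(1) U] by (simp add: free_alg_def)
      have "c \<odot>\<^bsub>?F\<^esub> y = Poly_Mapping.single 0 c * i + c \<odot>\<^bsub>?F\<^esub> x"
        by (simp add: i free_alg_def algebra_simps)
      hence "c \<odot>\<^bsub>?F\<^esub> y \<in> ?h (c \<odot>\<^bsub>?F\<^esub> x)"
        using ci by (auto simp: a_r_coset_def' free_alg_def)
      thus ?thesis by (rule a_repr_independence'[symmetric, OF _ U])
    qed
    moreover have "x \<in> ?h x" by (rule a_rcos_self[OF U])
    ultimately show ?thesis by blast
  qed
  have rh: "?h \<in> ring_hom ?F (?F Quot ?I)" by (rule rcos_ring_hom)
  have "?h \<in> alg_hom ?F (presented_alg R)"
    using rh by (auto simp: alg_hom_def ring_hom_def Q sm)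
  moreover have "?h ` carrier ?F = carrier (presented_alg R)"
    by (auto simp: Q FactRing_def A_RCOSETS_def' )
  moreover have "a_kernel ?F (presented_alg R) ?h = ?I"
  proof -
    have "?h x = ?I \<longleftrightarrow> x \<in> ?I" for x
      using a_rcos_self[OF U, of x] a_rcos_const[of x] by auto
    thus ?thesis by (auto simp: a_kernel_def' Q FactRing_def U)
  qed
  ultimately show ?thesis
    unfolding has_presentation_def by (intro bexI[of _ ?h]) (auto simp: presented_gen_def)
qed


section \<open>Commutators\<close>

text \<open>\<open>qcomm A q x y\<close> is the $q$-commutator, so \<open>qcomm A (1 / q)\<close> is the $q^{-1}$-commutator.\<close>

definition comm :: "('f::field, 'a, 'm) module_scheme \<Rightarrow> 'a \<Rightarrow> 'a \<Rightarrow> 'a" where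
  "comm A x y = (x \<otimes>\<^bsub>A\<^esub> y) \<ominus>\<^bsub>A\<^esub> (y \<otimes>\<^bsub>A\<^esub> x)"

definition qcomm :: "('f::field, 'a, 'm) module_scheme \<Rightarrow> 'f \<Rightarrow> 'a \<Rightarrow> 'a \<Rightarrow> 'a" where
  "qcomm A q x y = (q \<odot>\<^bsub>A\<^esub> (x \<otimes>\<^bsub>A\<^esub> y)) \<ominus>\<^bsub>A\<^esub> ((1 / q) \<odot>\<^bsub>A\<^esub> (y \<otimes>\<^bsub>A\<^esub> x))"

text \<open>
  A family indexed by the positive integers is stored as \<open>f :: nat \<Rightarrow> 'a\<close> with \<open>f k\<close> of index
  \<open>k + 1\<close>; \<open>from0 A f\<close> is the same family with its natural indexing, extended by $1$ at index $0$.
\<close>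

definition from0 :: "('f, 'a, 'm) module_scheme \<Rightarrow> (nat \<Rightarrow> 'a) \<Rightarrow> nat \<Rightarrow> 'a" where
  "from0 A f n = (case n of 0 \<Rightarrow> \<one>\<^bsub>A\<^esub> | Suc k \<Rightarrow> f k)"


section \<open>The algebra $\mathcal U$\<close>

text \<open>\<open>C_Gt k\<close> is the generator $\tilde G_{k+1}$.\<close>

datatype compact_gen = C_W0 | C_W1 | C_Gt nat

text \<open>Here \<open>Gt k\<close> is $\tilde G_k$, with \<open>Gt 0\<close> the identity.\<close>

definition compact_relations ::
    "('f::field, 'a, 'm) module_scheme \<Rightarrow> 'f \<Rightarrow> 'a \<Rightarrow> 'a \<Rightarrow> (nat \<Rightarrow> 'a) \<Rightarrow> ('a \<times> 'a) set" where
  "compact_relations A q W0 W1 Gt =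
     {(comm A W0 (qcomm A (1/q) W0 (qcomm A q W0 W1)), \<zero>\<^bsub>A\<^esub>),
      (comm A W1 (qcomm A (1/q) W1 (qcomm A q W1 W0)), \<zero>\<^bsub>A\<^esub>),
      (comm A (Gt 1) W1,
         (q / (q^2 - 1/q^2)) \<odot>\<^bsub>A\<^esub> comm A (qcomm A q W0 W1) W1),
      (comm A W0 (Gt 1),
         (q / (q^2 - 1/q^2)) \<odot>\<^bsub>A\<^esub> comm A W0 (qcomm A q W0 W1))}
   \<union> (\<Union>k\<in>{1..}.
       {(comm A (Gt (k+1)) W1,
           (1 / ((1 - 1/q^2) * (q^2 - 1/q^2))) \<odot>\<^bsub>A\<^esub>
             comm A (qcomm A q (qcomm A q (Gt k) W0) W1) W1),
        (comm A W0 (Gt (k+1)),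
           (1 / ((1 - 1/q^2) * (q^2 - 1/q^2))) \<odot>\<^bsub>A\<^esub>
             comm A W0 (qcomm A q W0 (qcomm A q W1 (Gt k))))})
   \<union> (\<Union>k l. {(comm A (Gt (k+1)) (Gt (l+1)), \<zero>\<^bsub>A\<^esub>)})"

definition U_relations ::
    "'f::field \<Rightarrow> ((compact_gen, 'f) falg \<times> (compact_gen, 'f) falg) set" where
  "U_relations q = compact_relations free_alg q (gen C_W0) (gen C_W1)
     (from0 free_alg (\<lambda>k. gen (C_Gt k)))"

definition U :: "'f::field \<Rightarrow> ('f, (compact_gen, 'f) falg set) module" where
  "U q = presented_alg (U_relations q)"

definition U_gen :: "'f::field \<Rightarrow> compact_gen \<Rightarrow> (compact_gen, 'f) falg set" where
  "U_gen q = presented_gen (U_relations q)"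

lemma U_has_presentation: "has_presentation (U q) (U_gen q) (U_relations q)"
  unfolding U_def U_gen_def by (rule presented_alg_has_presentation)


section \<open>The alternating elements\<close>

text \<open>
  The family $(W_i)_{i\in\mathbb Z}$ is split into two families indexed by \<open>nat\<close>: below, \<open>Wn k\<close>
  stands for $W_{-k}$ and \<open>Wp k\<close> for $W_{k+1}$. On the other hand \<open>G k\<close> and \<open>Gt k\<close> stand for
  $G_k$ and $\tilde G_k$.
\<close>

definition U_Gt :: "'f::field \<Rightarrow> nat \<Rightarrow> (compact_gen, 'f) falg set" where
  "U_Gt q = from0 (U q) (\<lambda>k. U_gen q (C_Gt k))"

definition U_Wn :: "'f::field \<Rightarrow> nat \<Rightarrow> (compact_gen, 'f) falg set" where
  "U_Wn q k = (1 / (q - 1/q)) \<odot>\<^bsub>U q\<^esub> qcomm (U q) q (U_Gt q k) (U_gen q C_W0)"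

definition U_Wp :: "'f::field \<Rightarrow> nat \<Rightarrow> (compact_gen, 'f) falg set" where
  "U_Wp q k = (1 / (q - 1/q)) \<odot>\<^bsub>U q\<^esub> qcomm (U q) q (U_gen q C_W1) (U_Gt q k)"

definition U_G :: "'f::field \<Rightarrow> nat \<Rightarrow> (compact_gen, 'f) falg set" where
  "U_G q = from0 (U q) (\<lambda>k. U_Gt q (k+1) \<oplus>\<^bsub>U q\<^esub>
     (1 / (1 - 1/q^2)) \<odot>\<^bsub>U q\<^esub> comm (U q) (U_gen q C_W1) (U_Wn q k))"

text \<open>
  \<open>A_Wn k\<close>, \<open>A_Wp k\<close>, \<open>A_G k\<close>, \<open>A_Gt k\<close> are the generators $W_{-k}$, $W_{k+1}$, $G_{k+1}$,
  $\tilde G_{k+1}$.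
\<close>

datatype alt_gen = A_Wn nat | A_Wp nat | A_G nat | A_Gt nat

primrec alternating_element ::
    "'f::field \<Rightarrow> alt_gen \<Rightarrow> (compact_gen, 'f) falg set" where
  "alternating_element q (A_Wn k) = U_Wn q k"
| "alternating_element q (A_Wp k) = U_Wp q k"
| "alternating_element q (A_G k) = U_G q (k+1)"
| "alternating_element q (A_Gt k) = U_Gt q (k+1)"

definition alternating_relations ::
    "('f::field, 'a, 'm) module_scheme \<Rightarrow> 'f \<Rightarrow>
      (nat \<Rightarrow> 'a) \<Rightarrow> (nat \<Rightarrow> 'a) \<Rightarrow> (nat \<Rightarrow> 'a) \<Rightarrow> (nat \<Rightarrow> 'a) \<Rightarrow> ('a \<times> 'a) set" where
  "alternating_relations A q Wn Wp G Gt = (\<Union>k l.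
     {(comm A (Wn 0) (Wp k), comm A (Wn k) (Wp 0)),
      (comm A (Wn k) (Wp 0), (1 - 1/q^2) \<odot>\<^bsub>A\<^esub> (Gt (k+1) \<ominus>\<^bsub>A\<^esub> G (k+1))),

      (qcomm A q (Wn 0) (G (k+1)), qcomm A q (Gt (k+1)) (Wn 0)),
      (qcomm A q (Gt (k+1)) (Wn 0), (q - 1/q) \<odot>\<^bsub>A\<^esub> Wn (k+1)),

      (qcomm A q (G (k+1)) (Wp 0), qcomm A q (Wp 0) (Gt (k+1))),
      (qcomm A q (Wp 0) (Gt (k+1)), (q - 1/q) \<odot>\<^bsub>A\<^esub> Wp (k+1)),

      (comm A (Wn k) (Wn l), \<zero>\<^bsub>A\<^esub>),
      (comm A (Wp k) (Wp l), \<zero>\<^bsub>A\<^esub>),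
      (comm A (Wn k) (Wp l) \<oplus>\<^bsub>A\<^esub> comm A (Wp k) (Wn l), \<zero>\<^bsub>A\<^esub>),
      (comm A (Wn k) (G (l+1)) \<oplus>\<^bsub>A\<^esub> comm A (G (k+1)) (Wn l), \<zero>\<^bsub>A\<^esub>),
      (comm A (Wn k) (Gt (l+1)) \<oplus>\<^bsub>A\<^esub> comm A (Gt (k+1)) (Wn l), \<zero>\<^bsub>A\<^esub>),
      (comm A (Wp k) (G (l+1)) \<oplus>\<^bsub>A\<^esub> comm A (G (k+1)) (Wp l), \<zero>\<^bsub>A\<^esub>),
      (comm A (Wp k) (Gt (l+1)) \<oplus>\<^bsub>A\<^esub> comm A (Gt (k+1)) (Wp l), \<zero>\<^bsub>A\<^esub>),
      (comm A (G (k+1)) (G (l+1)), \<zero>\<^bsub>A\<^esub>),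
      (comm A (Gt (k+1)) (Gt (l+1)), \<zero>\<^bsub>A\<^esub>),
      (comm A (Gt (k+1)) (G (l+1)) \<oplus>\<^bsub>A\<^esub> comm A (G (k+1)) (Gt (l+1)), \<zero>\<^bsub>A\<^esub>),

      (qcomm A q (Wn k) (G l), qcomm A q (Wn l) (G k)),
      (qcomm A q (G k) (Wp l), qcomm A q (G l) (Wp k)),
      (qcomm A q (Gt k) (Wn l), qcomm A q (Gt l) (Wn k)),
      (qcomm A q (Wp l) (Gt k), qcomm A q (Wp k) (Gt l)),
      (comm A (G k) (Gt (l+1)) \<ominus>\<^bsub>A\<^esub> comm A (G l) (Gt (k+1)),
         q \<odot>\<^bsub>A\<^esub> qcomm A q (Wn l) (Wp k) \<ominus>\<^bsub>A\<^esub> q \<odot>\<^bsub>A\<^esub> qcomm A q (Wn k) (Wp l)),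
      (comm A (Gt k) (G (l+1)) \<ominus>\<^bsub>A\<^esub> comm A (Gt l) (G (k+1)),
         q \<odot>\<^bsub>A\<^esub> qcomm A q (Wp l) (Wn k) \<ominus>\<^bsub>A\<^esub> q \<odot>\<^bsub>A\<^esub> qcomm A q (Wp k) (Wn l)),
      (qcomm A q (G (k+1)) (Gt (l+1)) \<ominus>\<^bsub>A\<^esub> qcomm A q (G (l+1)) (Gt (k+1)),
         q \<odot>\<^bsub>A\<^esub> comm A (Wn l) (Wp (k+1)) \<ominus>\<^bsub>A\<^esub> q \<odot>\<^bsub>A\<^esub> comm A (Wn k) (Wp (l+1))),
      (qcomm A q (Gt (k+1)) (G (l+1)) \<ominus>\<^bsub>A\<^esub> qcomm A q (Gt (l+1)) (G (k+1)),
         q \<odot>\<^bsub>A\<^esub> comm A (Wp l) (Wn (k+1)) \<ominus>\<^bsub>A\<^esub> q \<odot>\<^bsub>A\<^esub> comm A (Wp k) (Wn (l+1)))})"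

definition alt_relations ::
    "'f::field \<Rightarrow> ((alt_gen, 'f) falg \<times> (alt_gen, 'f) falg) set" where
  "alt_relations q = alternating_relations free_alg q
     (\<lambda>k. gen (A_Wn k)) (\<lambda>k. gen (A_Wp k))
     (from0 free_alg (\<lambda>k. gen (A_G k))) (from0 free_alg (\<lambda>k. gen (A_Gt k)))"

end

theory Submission
  imports Defs
begin

text \<open>
  The relations are proved by induction on the degree, starting from
  $\lbrack\tilde G_k,\tilde G_\ell\rbrack=0$. The defining relations of the alternating elements,
  in the degrees where they are already known, say how $W_0$ and $W_1$ pass each $W_{-k}$,
  $W_{k+1}$, $G_k$ and $\tilde G_k$. Moving $W_0$ (or $W_1$) through a quadratic relation from right to
  left therefore produces a new quadratic relation of higher degree, and all of them arise in this
  way from $\lbrack\tilde G_k,\tilde G_\ell\rbrack=0$.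

  The only gap is the relation $\lbrack W_0,W_{n+1}\rbrack=\lbrack W_{-n},W_1\rbrack$, which is
  not built into the definitions (it makes the two natural definitions of $G_{n+1}$ agree). Put
  $e_k=\lbrack W_{-k},W_{n-k+1}\rbrack-\lbrack W_{k-n},W_{k+1}\rbrack$ and
  $\nu_k=q^{-1}(\lbrack\tilde G_{n+1-k},G_k\rbrack-\lbrack\tilde G_k,G_{n+1-k}\rbrack)$. The
  relations of degree $n+1$ obtained by moving generators show that the sequence
  $\nu_0,e_0,\nu_1,e_1,\ldots,\nu_{n+1}$ satisfies $x_{j+1}=(q+q^{-1})x_j-x_{j-1}$. As
  $\nu_0=\nu_{n+1}=0$, it follows that $\lbrack 2n+2\rbrack_q\,e_0=0$, hence $e_0=0$.

  Conversely, the compact relations and the formulas for the alternating elements follow from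
  a few of the alternating relations, so the two kernels correspond under the substitutions between
  the two free algebras.
\<close>

section \<open>Rings with a scaling automorphism\<close>

text \<open>
  \<open>Q\<close> and \<open>P\<close> are multiplication by $q$ and $q^{-1}$. They are functions and not central
  elements so that the simplifier can pull all scalars out of a product without looping.
\<close>

locale q_scaling =
  fixes Q P :: "'r::{ring,monoid_mult} \<Rightarrow> 'r"
  assumes Q_add [simp]: "Q (x + y) = Q x + Q y"
    and P_add [simp]: "P (x + y) = P x + P y"
    and Q_mult_left [simp]: "Q x * y = Q (x * y)"
    and P_mult_left [simp]: "P x * y = P (x * y)"
    and Q_mult_right [simp]: "x * Q y = Q (x * y)"
    and P_mult_right [simp]: "x * P y = P (x * y)"
    and Q_P [simp]: "Q (P x) = x"
    and P_Q [simp]: "P (Q x) = x"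
    and not_root: "n > 0 \<Longrightarrow> (Q ^^ n) x = (P ^^ n) x \<Longrightarrow> x = 0"
begin

lemma Q_0 [simp]: "Q 0 = 0" and P_0 [simp]: "P 0 = 0"
  using Q_add[of 0 0] P_add[of 0 0] by simp_all

lemma Q_minus [simp]: "Q (- x) = - Q x" and P_minus [simp]: "P (- x) = - P x"
  using Q_add[of x "- x"] P_add[of x "- x"] by (simp_all add: eq_neg_iff_add_eq_0 add.commute)

lemma Q_diff [simp]: "Q (x - y) = Q x - Q y" and P_diff [simp]: "P (x - y) = P x - P y"
  using Q_add[of x "- y"] P_add[of x "- y"] by simp_all

lemma Q_eq_iff [simp]: "Q x = Q y \<longleftrightarrow> x = y" and P_eq_iff [simp]: "P x = P y \<longleftrightarrow> x = y"
  by (metis P_Q, metis Q_P)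

lemma Q_eq_P_iff [simp]: "Q x = P x \<longleftrightarrow> x = 0"
  using not_root[of 1 x] by auto

lemma Q_minus_P_cancel: "Q x - P x = Q y - P y \<Longrightarrow> x = y"
  using Q_eq_P_iff[of "x - y"] by (simp add: algebra_simps)

lemma Q_plus_P_eq_0_iff [simp]: "Q x + P x = 0 \<longleftrightarrow> x = 0"
proof
  assume "Q x + P x = 0"
  then have "Q (Q x + P x) = P (Q x + P x)" by simp
  then have "(Q ^^ 2) x = (P ^^ 2) x" by (simp add: eval_nat_numeral)
  then show "x = 0" using not_root[of 2 x] by simp
qed simp

section \<open>Commutators and the rules for moving a generator through a product\<close>

definition qc :: "'r \<Rightarrow> 'r \<Rightarrow> 'r" where
  "qc x y = Q (x * y) - P (y * x)"

definition cm :: "'r \<Rightarrow> 'r \<Rightarrow> 'r" where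
  "cm x y = x * y - y * x"

text \<open>
  Rules for moving \<open>A\<close> from right to left: \<open>low\<close> is the rule for $\tilde G_k$ past $W_0$ and for
  $G_k$ past $W_1$, \<open>up\<close> the one for $G_k$ past $W_0$ and $\tilde G_k$ past $W_1$, and \<open>mix\<close> the one for
  $W_{k+1}$ past $W_0$ and $W_{-k}$ past $W_1$, with \<open>d\<close> the difference of $\tilde G_{k+1}$ and $G_{k+1}$.
\<close>

definition low :: "'r \<Rightarrow> 'r \<Rightarrow> 'r \<Rightarrow> bool" where
  "low A x a \<longleftrightarrow> x * A = P (P (A * x)) + (a - P (P a))"

definition up :: "'r \<Rightarrow> 'r \<Rightarrow> 'r \<Rightarrow> bool" where
  "up A x a \<longleftrightarrow> x * A = Q (Q (A * x)) - (Q (Q a) - a)"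

definition mix :: "'r \<Rightarrow> 'r \<Rightarrow> 'r \<Rightarrow> bool" where
  "mix A b d \<longleftrightarrow> b * A = A * b - (d - P (P d))"

lemma low_iff: "low A x a \<longleftrightarrow> qc x A = Q a - P a"
proof -
  have "qc x A - (Q a - P a) = Q (x * A - (P (P (A * x)) + (a - P (P a))))"
    by (simp add: qc_def)
  then show ?thesis unfolding low_def
    by (metis Q_0 Q_eq_iff right_minus_eq)
qed

lemma up_iff: "up A x a \<longleftrightarrow> qc A x = Q a - P a"
proof -
  have "qc A x - (Q a - P a) = - P (x * A - (Q (Q (A * x)) - (Q (Q a) - a)))"
    by (simp add: qc_def)
  then show ?thesis unfolding up_def
    by (metis P_0 P_eq_iff right_minus_eq neg_equal_0_iff_equal)
qed

lemma mult_left_rule: "x * A = y \<Longrightarrow> x * (A * z) = y * z" for x A y z :: 'r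
  by (simp add: mult.assoc[symmetric])

lemmas expand = qc_def cm_def algebra_simps

lemma P_P_eq_iff [simp]: "P (P x) = x \<longleftrightarrow> x = 0"
  by (metis Q_P Q_eq_P_iff P_0)

lemma cm_diff: "cm (x - y) z = cm x z - cm y z" "cm z (x - y) = cm z x - cm z y"
  by (simp_all add: cm_def algebra_simps)

lemma Q_Q_eq_P_P_iff [simp]: "Q (Q x) = P (P x) \<longleftrightarrow> x = 0"
  using not_root[of 2 x] by (auto simp: eval_nat_numeral)

lemma cm_swap: "cm x y = - cm y x"
  by (simp add: cm_def)

text \<open>Each derivation below yields the wanted expression multiplied by 1 - q^-2. The vanishing
  of the right side is a separate premise: the first premise is then an identity that rests on the
  moving rules alone, and the known relation is put in afterwards.\<close>

lemma minus_P_P_cancel: "x - P (P x) = y \<Longrightarrow> y = 0 \<Longrightarrow> x = 0"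
  using P_P_eq_iff[of x] by simp

text \<open>
  Below, \<open>gk\<close>, \<open>g'k\<close> stand for $\tilde G_k$, $\tilde G_{k+1}$, and similarly for the other letters.
  The lemmas are stated for arbitrary elements because each is needed a second time with the roles of
  $W_0,W_{-k},\tilde G_k$ and $W_1,W_{k+1},G_k$ exchanged.
\<close>

lemma qc_of_low_low:
  assumes "low A gk ak" "low A gl al" "cm gk gl = 0"
  shows "qc gk al = qc gl ak"
proof -
  note r = assms(1,2)[unfolded low_def]
  let ?E = "qc gk al - qc gl ak"
  \<comment> \<open>For c the commutator of \<open>gk\<close> and \<open>gl\<close>, moving
    \<open>A\<close> to the left turns c A into q^-4 A c plus q^-1 (1 - q^-2) \<open>?E\<close>: one
    factor at a time is replaced by its partner \<open>ak\<close> or \<open>al\<close>. The next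
    lemmas follow the same scheme.\<close>
  have *: "?E - P (P ?E) = Q (cm gk gl * A - P (P (P (P (A * cm gk gl)))))"
    by (simp add: expand r r[THEN mult_left_rule])
  have "?E = 0" by (rule minus_P_P_cancel[OF *]) (simp add: assms(3))
  then show ?thesis by simp
qed

lemma qc_of_up_up:
  assumes "up A hk ak" "up A hl al" "cm hk hl = 0"
  shows "qc ak hl = qc al hk"
proof -
  note r = assms(1,2)[unfolded up_def]
  let ?E = "qc al hk - qc ak hl"
  have *: "?E - P (P ?E) = P (P (P (cm hk hl * A - Q (Q (Q (Q (A * cm hk hl)))))))"
    by (simp add: expand r r[THEN mult_left_rule])
  have "?E = 0" by (rule minus_P_P_cancel[OF *]) (simp add: assms(3))
  then show ?thesis by simp
qed

lemma cm_g_d_of_g_a: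
  assumes "up B gk bk" "up B gl bl" "mix B ak (- dk)" "mix B al (- dl)"
    and X: "qc gk al = qc gl ak"
  shows "cm gk dl - cm gl dk = Q (qc bk al) - Q (qc bl ak)"
proof -
  note r = assms(1-2)[unfolded up_def] assms(3-4)[unfolded mix_def]
  let ?X = "qc gk al - qc gl ak"
  let ?E = "cm gk dl - cm gl dk - (Q (qc bk al) - Q (qc bl ak))"
  have *: "?E - P (P ?E) = P (?X * B - Q (Q (B * ?X)))"
    by (simp add: expand r r[THEN mult_left_rule])
  have "?E = 0" by (rule minus_P_P_cancel[OF *]) (simp add: X)
  then show ?thesis by simp
qed

lemma cm_d_h_of_a_h:
  assumes "low B hk bk" "low B hl bl" "mix B ak (- dk)" "mix B al (- dl)"
    and X: "qc ak hl = qc al hk"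
  shows "cm dk hl - cm dl hk = Q (qc al bk) - Q (qc ak bl)"
proof -
  note r = assms(1-2)[unfolded low_def] assms(3-4)[unfolded mix_def]
  let ?X = "qc ak hl - qc al hk"
  let ?E = "cm dk hl - cm dl hk - (Q (qc al bk) - Q (qc ak bl))"
  have *: "?E - P (P ?E) = Q (?X * B - P (P (B * ?X)))"
    by (simp add: expand r r[THEN mult_left_rule])
  have "?E = 0" by (rule minus_P_P_cancel[OF *]) (simp add: X)
  then show ?thesis by simp
qed

text \<open>The factors q^-2 of \<open>low\<close> and q^2 of \<open>up\<close> cancel, so
  \<open>A\<close> passes through \<open>X\<close> with coefficient 1. What is left over is q + q^-1
  times the wanted sum, minus the known relations \<open>Y\<close>.\<close>

lemma cm_a_h_of_g_h:
  assumes "low A gk ak" "low A gl al" "up A h'k a'k" "up A h'l a'l"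
    "mix A bk (g'k - h'k)" "mix A bl (g'l - h'l)" "ak * A = A * ak" "al * A = A * al"
    and Y: "qc gk a'l = qc g'l ak" "qc gl a'k = qc g'k al"
    and X: "cm gk h'l - cm gl h'k = Q (qc bl ak) - Q (qc bk al)"
  shows "cm ak h'l + cm h'k al = 0"
proof -
  note r = assms(1-2)[unfolded low_def] assms(3-4)[unfolded up_def] assms(5-6)[unfolded mix_def]
    assms(7-8)
  let ?X = "cm gk h'l - cm gl h'k - (Q (qc bl ak) - Q (qc bk al))"
  let ?Y = "qc gk a'l - qc g'l ak - (qc gl a'k - qc g'k al)"
  let ?E = "cm ak h'l + cm h'k al"
  have *: "(Q ?E + P ?E - ?Y) - P (P (Q ?E + P ?E - ?Y)) = P (?X * A - A * ?X)"
    by (simp add: expand r r[THEN mult_left_rule])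
  have "Q ?E + P ?E - ?Y = 0" by (rule minus_P_P_cancel[OF *]) (simp add: X)
  then have "Q ?E + P ?E = 0" using Y by simp
  then show ?thesis by (simp only: Q_plus_P_eq_0_iff)
qed

lemma cm_a_g_of_h_g:
  assumes "up A hk ak" "up A hl al" "low A g'k a'k" "low A g'l a'l"
    "mix A bk (g'k - h'k)" "mix A bl (g'l - h'l)" "ak * A = A * ak" "al * A = A * al"
    and Y: "qc ak h'l = qc a'l hk" "qc al h'k = qc a'k hl"
    and X: "cm hk g'l - cm hl g'k = Q (qc al bk) - Q (qc ak bl)"
  shows "cm ak g'l + cm g'k al = 0"
proof -
  note r = assms(1-2)[unfolded up_def] assms(3-4)[unfolded low_def] assms(5-6)[unfolded mix_def]
    assms(7-8)
  let ?X = "cm hk g'l - cm hl g'k - (Q (qc al bk) - Q (qc ak bl))"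
  let ?Y = "qc ak h'l - qc a'l hk - (qc al h'k - qc a'k hl)"
  let ?E = "cm ak g'l + cm g'k al"
  have *: "(Q ?E + P ?E - ?Y) - P (P (Q ?E + P ?E - ?Y)) = - P (?X * A - A * ?X)"
    by (simp add: expand r r[THEN mult_left_rule])
  have "Q ?E + P ?E - ?Y = 0" by (rule minus_P_P_cancel[OF *]) (simp add: X)
  then have "Q ?E + P ?E = 0" using Y by simp
  then show ?thesis by (simp only: Q_plus_P_eq_0_iff)
qed

lemma cm_a_a_of_a_g:
  assumes "low A g'k a'k" "low A g'l a'l" "ak * A = A * ak" "al * A = A * al"
    and X: "cm ak g'l + cm g'k al = 0"
  shows "cm ak a'l + cm a'k al = 0"
proof -
  note r = assms(1-2)[unfolded low_def] assms(3-4)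
  let ?X = "cm ak g'l + cm g'k al"
  let ?E = "cm ak a'l + cm a'k al"
  have *: "?E - P (P ?E) = ?X * A - P (P (A * ?X))"
    by (simp add: expand r r[THEN mult_left_rule])
  show ?thesis by (rule minus_P_P_cancel[OF *]) (simp add: X)
qed

lemma cm_a_a_of_g_a:
  assumes "low A gk ak" "low A gl al" "ak * A = A * ak" "al * A = A * al"
    and X: "qc gk al = qc gl ak"
  shows "cm ak al = 0"
proof -
  note r = assms(1-2)[unfolded low_def] assms(3-4)
  let ?X = "qc gk al - qc gl ak"
  let ?E = "Q (cm ak al) + P (cm ak al)"
  have *: "?E - P (P ?E) = ?X * A - P (P (A * ?X))"
    by (simp add: expand r r[THEN mult_left_rule])
  have "?E = 0" by (rule minus_P_P_cancel[OF *]) (simp add: X)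
  then show ?thesis by simp
qed

lemma qc_h_g_of_a_g:
  assumes "up B g'k b'k" "up B g'l b'l" "mix B ak (h'k - g'k)" "mix B al (h'l - g'l)"
    and gg: "cm g'k g'l = 0"
    and X: "cm ak g'l + cm g'k al = 0"
  shows "qc h'k g'l - qc h'l g'k = Q (cm al b'k) - Q (cm ak b'l)"
proof -
  note r = assms(1-2)[unfolded up_def] assms(3-4)[unfolded mix_def]
  let ?X = "cm ak g'l + cm g'k al"
  let ?E = "qc h'k g'l - qc h'l g'k - (Q (cm al b'k) - Q (cm ak b'l))"
  let ?F = "Q (cm g'k g'l) + P (cm g'k g'l)"
  have *: "(?F - ?E) - P (P (?F - ?E)) = P (?X * B - Q (Q (B * ?X)))"
    by (simp add: expand r r[THEN mult_left_rule])
  have "?F - ?E = 0" by (rule minus_P_P_cancel[OF *]) (simp add: X)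
  then show ?thesis using gg by simp
qed

text \<open>Unlike in \<open>qc_h_g_of_a_g\<close>, the commutator of \<open>h'k\<close> and
  \<open>h'l\<close> is not assumed to vanish but kept on the right; \<open>hh_next\<close> compares
  the two lemmas to get rid of it.\<close>

lemma qc_h_g_of_a_h:
  assumes "low B h'k b'k" "low B h'l b'l" "mix B ak (h'k - g'k)" "mix B al (h'l - g'l)"
    and X: "cm ak h'l + cm h'k al = 0"
  shows "qc h'k g'l - qc h'l g'k - (Q (cm al b'k) - Q (cm ak b'l))
    = Q (cm h'k h'l) + P (cm h'k h'l)"
proof -
  note r = assms(1-2)[unfolded low_def] assms(3-4)[unfolded mix_def]
  let ?X = "cm ak h'l + cm h'k al"
  let ?E = "qc h'k g'l - qc h'l g'k - (Q (cm al b'k) - Q (cm ak b'l))"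
  let ?F = "Q (cm h'k h'l) + P (cm h'k h'l)"
  have *: "(?E - ?F) - P (P (?E - ?F)) = Q (?X * B - P (P (B * ?X)))"
    by (simp add: expand r r[THEN mult_left_rule])
  have "?E - ?F = 0" by (rule minus_P_P_cancel[OF *]) (simp add: X)
  then show ?thesis by simp
qed

text \<open>The recurrence is that of the q-integers: x_0 = 0 gives (q - q^-1) x_j = (q^j - q^-j)
  x_1, and the vanishing at \<open>n\<close> kills x_1 because q is not a root of unity.\<close>

lemma recurrence_zero:
  assumes 0: "x 0 = 0" and rec: "\<And>j. Suc j < n \<Longrightarrow> x (Suc (Suc j)) = Q (x (Suc j)) + P (x (Suc j)) - x j"
    and n: "0 < n" "x n = 0" and "j \<le> n"
  shows "x j = 0"
proof -
  have pow: "(Q ^^ j) (Q y) = Q ((Q ^^ j) y)" "(P ^^ j) (P y) = P ((P ^^ j) y)"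
    "P ((Q ^^ j) (Q y)) = (Q ^^ j) y" "Q ((P ^^ j) (P y)) = (P ^^ j) y" for j y
    by (induction j) simp_all
  have zero: "(Q ^^ j) 0 = 0" "(P ^^ j) 0 = 0" for j
    by (induction j) simp_all
  have *: "j \<le> n \<Longrightarrow> Q (x j) - P (x j) = (Q ^^ j) (x 1) - (P ^^ j) (x 1)" for j
  proof (induction j rule: induct_nat_012)
    case (ge2 j)
    have "Q (x (Suc (Suc j))) - P (x (Suc (Suc j)))
      = Q (Q (x (Suc j)) - P (x (Suc j))) + P (Q (x (Suc j)) - P (x (Suc j))) - (Q (x j) - P (x j))"
      using rec[of j] ge2.prems by simp
    also have "\<dots> = (Q ^^ Suc (Suc j)) (x 1) - (P ^^ Suc (Suc j)) (x 1)"
      using ge2 by (simp add: pow)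
    finally show ?case .
  qed (simp_all add: 0)
  have "x 1 = 0" using *[of n] n not_root[of n "x 1"] by simp
  then show ?thesis using *[of j] \<open>j \<le> n\<close> zero by simp
qed

end

text \<open>
  $A,B$ are $W_0,W_1$, and \<open>g\<close>, \<open>h\<close>, \<open>a k\<close>, \<open>b k\<close> are $\tilde G$, $G$, $W_{-k}$, $W_{k+1}$. The
  rule for moving $G_{n+1}$ past $W_0$ is only available once
  $\lbrack W_0,W_{n+1}\rbrack=\lbrack W_{-n},W_1\rbrack$ is known.
\<close>

locale alternating_family = q_scaling Q P for Q P :: "'r::{ring,monoid_mult} \<Rightarrow> 'r" +
  fixes A B :: 'r and g a b h :: "nat \<Rightarrow> 'r"
  assumes g_0 [simp]: "g 0 = 1" and h_0 [simp]: "h 0 = 1"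
    and gg: "cm (g k) (g l) = 0"
    and gA: "low A (g k) (a k)"
    and gB: "up B (g k) (b k)"
    and hB: "low B (h k) (b k)"
    and aB: "mix B (a k) (h (Suc k) - g (Suc k))"
    and hA_step: "cm A (b n) = cm (a n) B \<Longrightarrow> up A (h (Suc n)) (a (Suc n))"
    and A_a1: "a 1 * A = A * a 1"
    and B_b1: "b 1 * B = B * b 1"
begin

section \<open>The alternating relations by induction on the degree\<close>

lemma a_0 [simp]: "a 0 = A"
proof -
  have *: "(A - a 0) - P (P (A - a 0)) = 0"
    using gA[of 0] by (simp add: low_def algebra_simps)
  show ?thesis using minus_P_P_cancel[OF *] by simp
qed

lemma b_0 [simp]: "b 0 = B"
proof -
  have *: "(B - b 0) - P (P (B - b 0)) = 0"
    using hB[of 0] by (simp add: low_def algebra_simps)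
  show ?thesis using minus_P_P_cancel[OF *] by simp
qed

text \<open>\<open>aB\<close> already determines [W_{-k},W_1], so the rule for \<open>b k\<close>
  past \<open>A\<close> amounts to the agreement of two commutators. This isolates the gap that the
  induction has to close.\<close>

lemma mix_A_iff: "mix A (b k) (g (Suc k) - h (Suc k)) \<longleftrightarrow> cm A (b k) = cm (a k) B"
proof -
  let ?d = "g (Suc k) - h (Suc k)"
  have "cm (a k) B = ?d - P (P ?d)"
    using aB[of k] by (simp add: mix_def cm_def)
  moreover have "mix A (b k) ?d \<longleftrightarrow> cm A (b k) = ?d - P (P ?d)"
    unfolding mix_def cm_def by (metis add_diff_cancel_left' diff_add_cancel diff_diff_eq2)
  ultimately show ?thesis by simp
qed

text \<open>This relation and the next two come from rules given in all degrees, so they stand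
  outside the induction.\<close>

lemma g_a: "qc (g k) (a l) = qc (g l) (a k)"
  by (rule qc_of_low_low[OF gA gA gg])

lemma b_g: "qc (b k) (g l) = qc (b l) (g k)"
  by (rule qc_of_up_up[OF gB gB gg])

lemma g_h_comm:
  "cm (g k) (h (Suc l)) - cm (g l) (h (Suc k)) = Q (qc (b l) (a k)) - Q (qc (b k) (a l))"
proof -
  have "cm (g k) (g (Suc l) - h (Suc l)) - cm (g l) (g (Suc k) - h (Suc k))
      = Q (qc (b k) (a l)) - Q (qc (b l) (a k))"
    by (rule cm_g_d_of_g_a[OF gB gB _ _ g_a]) (simp_all add: aB)
  then show ?thesis
    by (simp add: cm_diff gg algebra_simps)
qed

text \<open>The induction hypothesis; the other relations in this range are rederived from it.
  \<open>mix\<close> at \<open>j\<close> involves the index \<open>Suc j\<close>, hence the bound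
  \<open>j < n\<close> there against \<open>j \<le> n\<close> for \<open>up\<close>.\<close>

definition holds_upto :: "nat \<Rightarrow> bool" where
  "holds_upto n \<longleftrightarrow>
     (\<forall>j\<le>n. up A (h j) (a j)) \<and>
     (\<forall>j<n. mix A (b j) (g (Suc j) - h (Suc j))) \<and>
     (\<forall>j<n. a j * A = A * a j \<and> b j * B = B * b j) \<and>
     (\<forall>k l. k + l \<le> n \<longrightarrow> cm (h k) (h l) = 0) \<and>
     (\<forall>k l. k + l < n \<longrightarrow>
        cm (h k) (g (Suc l)) - cm (h l) (g (Suc k)) = Q (qc (a l) (b k)) - Q (qc (a k) (b l)))"

lemma holds_upto_0: "holds_upto 0"
  by (simp add: holds_upto_def up_def cm_def)

context
  fixes n assumes n: "holds_upto n"
begin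

lemma hA: "j \<le> n \<Longrightarrow> up A (h j) (a j)"
  and bA: "j < n \<Longrightarrow> mix A (b j) (g (Suc j) - h (Suc j))"
  and aA: "j < n \<Longrightarrow> a j * A = A * a j"
  and bB: "j < n \<Longrightarrow> b j * B = B * b j"
  and hh: "k + l \<le> n \<Longrightarrow> cm (h k) (h l) = 0"
  and h_g_comm: "k + l < n \<Longrightarrow>
     cm (h k) (g (Suc l)) - cm (h l) (g (Suc k)) = Q (qc (a l) (b k)) - Q (qc (a k) (b l))"
  using n by (simp_all add: holds_upto_def)

lemma a_h: "k + l \<le> n \<Longrightarrow> qc (a k) (h l) = qc (a l) (h k)"
  by (rule qc_of_up_up[OF hA hA hh]) auto

lemma h_b: "k + l \<le> n \<Longrightarrow> qc (h k) (b l) = qc (h l) (b k)"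
  by (rule qc_of_low_low[OF hB hB hh]) auto

lemma a_h_comm: "k + l < n \<Longrightarrow> cm (a k) (h (Suc l)) + cm (h (Suc k)) (a l) = 0"
  by (rule cm_a_h_of_g_h[OF gA gA hA hA bA bA aA aA g_a g_a g_h_comm]) auto

lemma a_g_comm: "k + l < n \<Longrightarrow> cm (a k) (g (Suc l)) + cm (g (Suc k)) (a l) = 0"
  by (rule cm_a_g_of_h_g[OF hA hA gA gA bA bA aA aA a_h a_h h_g_comm]) auto

lemma b_g_comm: "k + l < n \<Longrightarrow> cm (b k) (g (Suc l)) + cm (g (Suc k)) (b l) = 0"
  by (rule cm_a_h_of_g_h[OF hB hB gB gB aB aB bB bB h_b h_b h_g_comm]) auto

lemma b_h_comm: "k + l < n \<Longrightarrow> cm (b k) (h (Suc l)) + cm (h (Suc k)) (b l) = 0"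
  by (rule cm_a_g_of_h_g[OF gB gB hB hB aB aB bB bB b_g b_g g_h_comm]) auto

lemma aa: "k < n \<Longrightarrow> l < n \<Longrightarrow> cm (a k) (a l) = 0"
  by (rule cm_a_a_of_g_a[OF gA gA aA aA g_a])

lemma bb: "k < n \<Longrightarrow> l < n \<Longrightarrow> k + l \<le> n \<Longrightarrow> cm (b k) (b l) = 0"
  by (rule cm_a_a_of_g_a[OF hB hB bB bB h_b])

lemma aA_next: "a n * A = A * a n"
proof (cases "n < 2")
  case True
  \<comment> \<open>For n = 1 the sum used in the other case would read [a_0,a_1] + [a_1,a_0] = 0
    and say nothing, so this case rests on \<open>A_a1\<close>.\<close>
  then have "n = 0 \<or> n = 1" by auto
  then show ?thesis using A_a1 by auto
next
  case False
  then obtain m where m: "n = Suc m" "0 < m" by (cases n) auto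
  \<comment> \<open>W_0 is \<open>a 0\<close>; the second summand vanishes because both of its
    indices are below \<open>n\<close>.\<close>
  have "cm (a 0) (a (Suc m)) + cm (a (Suc 0)) (a m) = 0"
    by (rule cm_a_a_of_a_g[OF gA gA aA aA a_g_comm]) (use m in auto)
  moreover have "cm (a (Suc 0)) (a m) = 0"
    by (rule aa) (use m in auto)
  ultimately show ?thesis by (simp add: cm_def m)
qed

lemma bB_next: "b n * B = B * b n"
proof (cases "n < 2")
  case True
  then have "n = 0 \<or> n = 1" by auto
  then show ?thesis using B_b1 by auto
next
  case False
  then obtain m where m: "n = Suc m" "0 < m" by (cases n) auto
  have "cm (b 0) (b (Suc m)) + cm (b (Suc 0)) (b m) = 0"
    by (rule cm_a_a_of_a_g[OF hB hB bB bB b_h_comm]) (use m in auto)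
  moreover have "cm (b (Suc 0)) (b m) = 0"
    by (rule bb) (use m in auto)
  ultimately show ?thesis by (simp add: cm_def m)
qed

lemma h_g_qc: "k + l < n \<Longrightarrow> qc (h (Suc k)) (g (Suc l)) - qc (h (Suc l)) (g (Suc k))
    = Q (cm (a l) (b (Suc k))) - Q (cm (a k) (b (Suc l)))"
  by (rule qc_h_g_of_a_g[OF gB gB aB aB gg a_g_comm])

text \<open>Moving W_1 through \<open>a_g_comm\<close> and through \<open>a_h_comm\<close> gives the
  same combination up to q + q^-1 times the commutator of \<open>h k\<close> and \<open>h l\<close>,
  which must therefore be 0.\<close>

lemma hh_next: assumes "k + l \<le> Suc n" shows "cm (h k) (h l) = 0"
proof (cases "k = 0 \<or> l = 0")
  case False
  then obtain k' l' where kl: "k = Suc k'" "l = Suc l'" "k' + l' < n"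
    using assms by (cases k; cases l) auto
  show ?thesis
    using qc_h_g_of_a_h[OF hB hB aB aB a_h_comm[OF kl(3)]] h_g_qc[OF kl(3)] by (simp add: kl)
qed (auto simp: cm_def)

text \<open>\<open>qc_h_g_of_a_h\<close> with W_0 and W_1 exchanged: the commutator kept there is
  now one of two \<open>g\<close>, zero by \<open>gg\<close>.\<close>

lemma g_h_qc:
  assumes "k + l < n"
  shows "qc (g (Suc k)) (h (Suc l)) - qc (g (Suc l)) (h (Suc k))
    = Q (cm (b l) (a (Suc k))) - Q (cm (b k) (a (Suc l)))"
proof -
  have "mix A (b k) (g (Suc k) - h (Suc k))" "mix A (b l) (g (Suc l) - h (Suc l))"
    using assms by (auto intro: bA)
  from qc_h_g_of_a_h[OF gA gA this b_g_comm[OF assms]] gg[of "Suc k" "Suc l"] show ?thesis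
    by simp
qed

text \<open>Moving W_1 through \<open>a_h\<close> brings in differences of \<open>g\<close> and
  \<open>h\<close>; their \<open>h\<close> part is removed by \<open>hh_next\<close>, which reaches
  degree \<open>Suc n\<close>.\<close>

lemma h_g_comm_next:
  assumes "k + l \<le> n"
  shows "cm (h k) (g (Suc l)) - cm (h l) (g (Suc k)) = Q (qc (a l) (b k)) - Q (qc (a k) (b l))"
proof -
  have "cm (g (Suc k) - h (Suc k)) (h l) - cm (g (Suc l) - h (Suc l)) (h k)
      = Q (qc (a l) (b k)) - Q (qc (a k) (b l))"
    by (rule cm_d_h_of_a_h[OF hB hB _ _ a_h]) (use assms in \<open>simp_all add: aB\<close>)
  then show ?thesis using assms
    by (simp add: cm_diff hh_next cm_swap[of "g _" "h _"])
qed

lemma a_b_comm_next: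
    "k + l = n \<Longrightarrow> cm (a k) (b l) + cm (b k) (a l) = 0" (is "_ \<Longrightarrow> ?ab")
  and g_h_comm_next:
    "k + l = n \<Longrightarrow> cm (g k) (h (Suc l)) + cm (h k) (g (Suc l)) = 0" (is "_ \<Longrightarrow> ?gh")
proof -
  define e where "e k = cm (a k) (b (n - k)) - cm (a (n - k)) (b k)" for k
  \<comment> \<open>The factor q^-1 gives both recurrences the same coefficient q + q^-1.\<close>
  define \<nu> where "\<nu> k = P (cm (g (Suc n - k)) (h k) - cm (g k) (h (Suc n - k)))" for k
  define x where "x j = (if even j then \<nu> (j div 2) else e (j div 2))" for j
  have e: "\<nu> k + \<nu> (Suc k) = Q (e k) + P (e k)" if kn: "k \<le> n" for k
  proof -
    obtain i where i: "n = k + i" using le_Suc_ex[OF kn] by auto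
    have "\<nu> k + \<nu> (Suc k) = - P (cm (g k) (h (Suc i)) - cm (g i) (h (Suc k))
        + (cm (h k) (g (Suc i)) - cm (h i) (g (Suc k))))"
      by (simp add: \<nu>_def i cm_def Suc_diff_le)
    also have "\<dots> = - P (Q (qc (b i) (a k)) - Q (qc (b k) (a i))
        + (Q (qc (a i) (b k)) - Q (qc (a k) (b i))))"
      by (simp only: g_h_comm h_g_comm_next i)
    also have "\<dots> = Q (e k) + P (e k)"
      by (simp add: e_def i expand)
    finally show ?thesis .
  qed
  have \<nu>: "e k + e (Suc k) = Q (\<nu> (Suc k)) + P (\<nu> (Suc k))" if kn: "Suc k \<le> n" for k
  proof -
    obtain i where i: "n = Suc (k + i)" using le_Suc_ex[OF kn] by auto
    then have "k + i < n" by simp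
    have "Q (\<nu> (Suc k)) + P (\<nu> (Suc k)) = - P (qc (g (Suc k)) (h (Suc i)) - qc (g (Suc i)) (h (Suc k))
        + (qc (h (Suc k)) (g (Suc i)) - qc (h (Suc i)) (g (Suc k))))"
      by (simp add: \<nu>_def i expand)
    also have "\<dots> = - P (Q (cm (b i) (a (Suc k))) - Q (cm (b k) (a (Suc i)))
        + (Q (cm (a i) (b (Suc k))) - Q (cm (a k) (b (Suc i)))))"
      by (simp only: h_g_qc[OF \<open>k + i < n\<close>] g_h_qc[OF \<open>k + i < n\<close>])
    also have "\<dots> = e k + e (Suc k)"
      by (simp add: e_def i expand Suc_diff_le)
    finally show ?thesis ..
  qed
  have "x j = 0" if "j \<le> 2 * n + 2" for j
  proof (rule recurrence_zero[OF _ _ _ _ that])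
    \<comment> \<open>At both ends of the sequence each commutator has an entry \<open>g 0\<close>
      or \<open>h 0\<close>, which is 1.\<close>
    show "x 0 = 0" by (simp add: x_def \<nu>_def cm_def)
    show "x (2 * n + 2) = 0" by (simp add: x_def \<nu>_def cm_def)
    fix j assume j: "Suc j < 2 * n + 2"
    show "x (Suc (Suc j)) = Q (x (Suc j)) + P (x (Suc j)) - x j"
    proof (cases "even j")
      case True
      then obtain i where "j = 2 * i" by (auto elim: evenE)
      with e[of i] j show ?thesis by (simp add: x_def eq_diff_eq add.commute)
    next
      case False
      then obtain i where "j = 2 * i + 1" by (auto elim: oddE)
      with \<nu>[of i] j show ?thesis by (simp add: x_def eq_diff_eq add.commute)
    qed
  qed simp
  note x = this
  show ?ab if kl: "k + l = n"
  proof -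
    have "e k = 0" "n - k = l" using x[of "2 * k + 1"] kl by (auto simp: x_def)
    then show ?thesis by (simp add: e_def cm_swap[of "b k"])
  qed
  show ?gh if kl: "k + l = n"
  proof -
    have "\<nu> k = 0" "Suc n - k = Suc l" using x[of "2 * k"] kl by (auto simp: x_def)
    then show ?thesis by (simp add: \<nu>_def cm_swap[of "h k"])
  qed
qed

text \<open>The case l = 0 of \<open>a_b_comm_next\<close> is the missing equality [W_0,W_{n+1}] =
  [W_{-n},W_1]. It unlocks the rules for \<open>b n\<close> and \<open>h (Suc n)\<close> past
  \<open>A\<close>.\<close>

lemma holds_upto_Suc: "holds_upto (Suc n)"
proof -
  have "cm A (b n) = cm (a n) B"
    using a_b_comm_next[of n 0] by (simp add: cm_def algebra_simps)
  then have "mix A (b n) (g (Suc n) - h (Suc n))" "up A (h (Suc n)) (a (Suc n))"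
    by (simp_all add: mix_A_iff hA_step)
  then show ?thesis
    using hA bA aA bB aA_next bB_next hh_next h_g_comm_next
    unfolding holds_upto_def less_Suc_eq_le
    by (metis le_Suc_eq le_neq_implies_less)
qed

end

lemma holds: "holds_upto n"
  by (induction n) (simp_all add: holds_upto_0 holds_upto_Suc)

text \<open>Each relation is taken at an \<open>n\<close> just large enough for its indices, so that
  the bounds disappear.\<close>

lemmas hA' = hA[OF holds order_refl]
lemmas bA' = bA[OF holds lessI]
lemmas bB' = bB[OF holds lessI]
lemmas aA' = aA[OF holds lessI]
lemmas hh' = hh[OF holds order_refl]
lemmas h_g_comm' = h_g_comm[OF holds lessI]

lemma cm_A_b: "cm A (b k) = cm (a k) B"
  using bA' mix_A_iff by simp

lemma cm_a_B: "cm (a k) B = (g (Suc k) - h (Suc k)) - P (P (g (Suc k) - h (Suc k)))"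
  using aB[of k] by (simp add: mix_def cm_def)

lemma qc_A_h: "qc A (h k) = Q (a k) - P (a k)"
  using hA' up_iff by blast

lemma qc_g_A: "qc (g k) A = Q (a k) - P (a k)"
  using gA low_iff by blast

lemma qc_h_B: "qc (h k) B = Q (b k) - P (b k)"
  using hB low_iff by blast

lemma qc_B_g: "qc B (g k) = Q (b k) - P (b k)"
  using gB up_iff by blast

lemma cm_a_a: "cm (a k) (a l) = 0"
  by (rule cm_a_a_of_g_a[OF gA gA aA' aA' g_a])

lemma cm_b_b: "cm (b k) (b l) = 0"
  by (rule cm_a_a_of_g_a[OF hB hB bB' bB' h_b[OF holds order_refl]])

lemmas a_b_comm = a_b_comm_next[OF holds refl]
lemmas a_h_comm' = a_h_comm[OF holds lessI]
lemmas a_g_comm' = a_g_comm[OF holds lessI]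
lemmas b_h_comm' = b_h_comm[OF holds lessI]
lemmas b_g_comm' = b_g_comm[OF holds lessI]
lemmas gh_hg_comm = g_h_comm_next[OF holds refl]
lemmas a_h' = a_h[OF holds order_refl]
lemmas h_b' = h_b[OF holds order_refl]
lemmas h_g_qc' = h_g_qc[OF holds lessI]
lemmas g_h_qc' = g_h_qc[OF holds lessI]

end

section \<open>The moving rules as consequences of the compact relations\<close>

locale compact_family = q_scaling Q P for Q P :: "'r::{ring,monoid_mult} \<Rightarrow> 'r" +
  fixes A B :: 'r and g a b h :: "nat \<Rightarrow> 'r"
  assumes g_0: "g 0 = 1" and h_0: "h 0 = 1"
    and g_comm: "cm (g k) (g l) = 0"
    and a: "qc (g k) A = Q (a k) - P (a k)"
    and b: "qc B (g k) = Q (b k) - P (b k)"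
    and h: "(h (Suc k) - g (Suc k)) - P (P (h (Suc k) - g (Suc k))) = cm B (a k)"
    and serre_A: "P (cm A (A * qc A B)) = Q (cm A (qc A B * A))"
    and serre_B: "P (cm B (B * qc B A)) = Q (cm B (qc B A * B))"
    and cm_g_B: "Q (Q (cm (g (Suc k)) B)) - P (P (cm (g (Suc k)) B)) = Q (cm (qc (a k) B) B)"
    and cm_A_g: "Q (Q (cm A (g (Suc k)))) - P (P (cm A (g (Suc k)))) = Q (cm A (qc A (b k)))"
begin

text \<open>In positive degree \<open>?E\<close> equals [d,W_1]_q + (q + q^-1)[G~,W_1] with d = G -
  G~. Multiplied by 1 - q^-2 it becomes a difference of double commutators with W_1, in which the
  plain and the q-commutator may be exchanged.\<close>

lemma qc_h_B: "qc (h k) B = Q (b k) - P (b k)"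
proof (cases k)
  case 0
  then show ?thesis using b[of 0] by (simp add: g_0 h_0 qc_def)
next
  case (Suc k)
  let ?d = "h (Suc k) - g (Suc k)" and ?x = "cm (g (Suc k)) B"
  let ?E = "qc (h (Suc k)) B - qc B (g (Suc k))"
  have "?E - P (P ?E) = P (Q (Q ?x) - P (P ?x)) + qc (?d - P (P ?d)) B"
    by (simp add: expand)
  also have "\<dots> = 0"
    by (simp only: cm_g_B h) (simp add: expand)
  finally have *: "?E - P (P ?E) = 0" .
  show ?thesis using minus_P_P_cancel[OF * refl] by (simp add: b Suc)
qed

text \<open>The mirror computation. Here \<open>cm_A_g\<close> contains \<open>b n\<close> while
  \<open>h\<close> is tied to \<open>a n\<close>, and the assumption joins the two.\<close>

lemma qc_A_h:
  assumes "cm A (b n) = cm (a n) B"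
  shows "qc A (h (Suc n)) = Q (a (Suc n)) - P (a (Suc n))"
proof -
  let ?d = "h (Suc n) - g (Suc n)" and ?x = "cm A (g (Suc n))"
  let ?E = "qc A (h (Suc n)) - qc (g (Suc n)) A"
  have "?E - P (P ?E) = P (Q (Q ?x) - P (P ?x)) + qc A (?d - P (P ?d))"
    by (simp add: expand)
  also have "\<dots> = P (Q (cm A (qc A (b n)))) - qc A (cm A (b n))"
    by (simp only: cm_A_g h cm_swap[of B] assms) (simp add: expand)
  also have "\<dots> = 0"
    by (simp add: expand)
  finally have *: "?E - P (P ?E) = 0" .
  show ?thesis using minus_P_P_cancel[OF * refl] by (simp add: a)
qed

lemma a_eq: "a 0 = A" and b_eq: "b 0 = B"
proof -
  show "a 0 = A" by (rule Q_minus_P_cancel) (use a[of 0] in \<open>simp add: g_0 qc_def\<close>)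
  show "b 0 = B" by (rule Q_minus_P_cancel) (use b[of 0] in \<open>simp add: g_0 qc_def\<close>)
qed

text \<open>By \<open>cm_A_g\<close> at index 0, a nonzero multiple of [W_{-1},W_0] turns into the
  q-Serre expression in W_0 and W_1.\<close>

lemma a_1: "a 1 * A = A * a 1"
proof -
  let ?x = "cm (a 1) A" and ?y = "cm A (g 1)"
  let ?z = "Q ?x - P ?x"
  have "?z = cm (Q (a 1) - P (a 1)) A"
    by (simp add: expand)
  then have z: "?z = cm (qc (g 1) A) A"
    by (simp only: a)
  have "Q (Q ?z) - P (P ?z)
      = P (A * (Q (Q ?y) - P (P ?y))) - Q ((Q (Q ?y) - P (P ?y)) * A)"
    unfolding z by (simp add: expand)
  also have "\<dots> = P (A * Q (cm A (qc A B))) - Q (Q (cm A (qc A B)) * A)"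
    using cm_A_g[of 0] by (simp add: b_eq)
  also have "P (A * Q (cm A (qc A B))) - Q (Q (cm A (qc A B)) * A)
     = Q (P (cm A (A * qc A B)) - Q (cm A (qc A B * A)))"
    by (simp add: expand)
  finally have "Q (Q ?z) = P (P ?z)"
    by (simp only: serre_A diff_self Q_0 right_minus_eq)
  then have "?z = 0" by (simp only: Q_Q_eq_P_P_iff)
  then have "?x = 0" by simp
  then show ?thesis by (simp add: cm_def)
qed

lemma b_1: "b 1 * B = B * b 1"
proof -
  let ?x = "cm (b 1) B" and ?y = "cm (g 1) B"
  let ?z = "Q ?x - P ?x"
  have "?z = cm (Q (b 1) - P (b 1)) B"
    by (simp add: expand)
  then have z: "?z = cm (qc B (g 1)) B"
    by (simp only: b)
  have "Q (Q ?z) - P (P ?z)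
      = Q (B * (Q (Q ?y) - P (P ?y))) - P ((Q (Q ?y) - P (P ?y)) * B)"
    unfolding z by (simp add: expand)
  also have "\<dots> = Q (B * Q (cm (qc A B) B)) - P (Q (cm (qc A B) B) * B)"
    using cm_g_B[of 0] by (simp add: a_eq)
  also have "Q (B * Q (cm (qc A B) B)) - P (Q (cm (qc A B) B) * B)
     = Q (P (cm B (B * qc B A)) - Q (cm B (qc B A * B)))"
    by (simp add: expand)
  finally have "Q (Q ?z) = P (P ?z)"
    by (simp only: serre_B diff_self Q_0 right_minus_eq)
  then have "?z = 0" by (simp only: Q_Q_eq_P_P_iff)
  then have "?x = 0" by simp
  then show ?thesis by (simp add: cm_def)
qed

sublocale alternating: alternating_family Q P A B g a b h
proof
  show "mix B (a k) (h (Suc k) - g (Suc k))" for k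
    using h[of k] by (simp add: mix_def cm_def algebra_simps)
qed (simp_all add: g_0 h_0 g_comm low_iff up_iff a b qc_h_B qc_A_h a_1[simplified] b_1[simplified])

end

section \<open>Free algebras\<close>

definition scalar :: "'f::field \<Rightarrow> ('g, 'f) falg" where
  "scalar c = Poly_Mapping.single 0 c"

lemma scalar_0 [simp]: "scalar 0 = 0" and scalar_1 [simp]: "scalar 1 = 1"
  and scalar_add: "scalar (c + d) = scalar c + scalar d"
  and scalar_diff: "scalar (c - d) = scalar c - scalar d"
  and scalar_mult: "scalar c * scalar d = scalar (c * d)"
  by (simp_all add: scalar_def single_add single_diff mult_single)

lemma scalar_mult_assoc: "scalar c * (scalar d * x) = scalar (c * d) * x"
  by (simp add: mult.assoc[symmetric] scalar_mult)

lemma single_Cons: "Poly_Mapping.single (Word (x # xs)) c = gen x * Poly_Mapping.single (Word xs) (c::'f::field)"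
  by (simp add: gen_def mult_single plus_word_def)

lemma falg_single_induct [case_names single add]:
  fixes p :: "('g, 'f::field) falg"
  assumes single: "\<And>w c. S (Poly_Mapping.single (Word w) c)"
    and add: "\<And>x y. S x \<Longrightarrow> S y \<Longrightarrow> S (x + y)"
  shows "S p"
proof (induction p rule: update_induct)
  case const
  then show ?case using single[of _ 0] by simp
next
  case (update p w c)
  have "Poly_Mapping.update w c p = p + Poly_Mapping.single w c"
    using update by (intro poly_mapping_eqI) (auto simp: lookup_update lookup_add lookup_single in_keys_iff when_def)
  moreover have "S (Poly_Mapping.single w c)"
    using single by (cases w) simp
  ultimately show ?case using update add by simp
qed

lemma falg_induct [case_names scalar gen add mult]:
  fixes p :: "('g, 'f::field) falg"
  assumes "\<And>c. S (scalar c)" "\<And>x. S (gen x)" "\<And>x y. S x \<Longrightarrow> S y \<Longrightarrow> S (x + y)"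
    "\<And>x y. S x \<Longrightarrow> S y \<Longrightarrow> S (x * y)"
  shows "S p"
proof (induction p rule: falg_single_induct)
  case (single w c)
  show ?case
  proof (induction w)
    case Nil
    then show ?case using assms(1)[of c] by (simp add: scalar_def zero_word_def)
  next
    case (Cons x w)
    then show ?case by (simp add: single_Cons assms)
  qed
qed (rule assms)

lemma scalar_commute: "scalar c * x = x * scalar c"
proof (induction x rule: falg_induct)
  case (scalar d)
  then show ?case by (simp add: scalar_mult mult.commute)
next
  case (gen x)
  then show ?case by (simp add: scalar_def gen_def mult_single)
next
  case (mult x y)
  then show ?case by (metis mult.assoc)
qed (simp add: algebra_simps)

lemma mult_scalar: "x * (scalar c * y) = scalar c * (x * y)"
  by (metis mult.assoc scalar_commute)

lemma falg_ops [simp]: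
  "carrier free_alg = UNIV" "x \<otimes>\<^bsub>free_alg\<^esub> y = x * y" "x \<oplus>\<^bsub>free_alg\<^esub> y = x + y"
  "\<one>\<^bsub>free_alg\<^esub> = 1" "\<zero>\<^bsub>free_alg\<^esub> = 0"
  by (simp_all add: free_alg_def)

lemma falg_smult: "c \<odot>\<^bsub>free_alg\<^esub> x = scalar c * x"
  by (simp add: free_alg_def scalar_def)

lemma falg_minus [simp]:
  "\<ominus>\<^bsub>free_alg\<^esub> x = - (x :: ('g, 'f::field) falg)" "x \<ominus>\<^bsub>free_alg\<^esub> y = x - (y :: ('g, 'f::field) falg)"
proof -
  interpret ring "free_alg :: ('f, ('g, 'f) falg) module" by (rule ring_free_alg)
  show *: "\<ominus>\<^bsub>free_alg\<^esub> x = - x" for x :: "('g, 'f) falg"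
    by (rule minus_equality) simp_all
  show "x \<ominus>\<^bsub>free_alg\<^esub> y = x - y"
    by (simp add: a_minus_def *)
qed

lemma comm_free_alg: "comm free_alg x y = x * y - y * x"
  by (simp add: comm_def)

section \<open>Two-sided ideals of the free algebra\<close>

definition two_sided :: "'a::ring_1 set \<Rightarrow> bool" where
  "two_sided I \<longleftrightarrow> 0 \<in> I \<and> (\<forall>x\<in>I. \<forall>y\<in>I. x + y \<in> I) \<and> (\<forall>x\<in>I. \<forall>r. r * x \<in> I \<and> x * r \<in> I)"

lemma
  assumes "two_sided I"
  shows two_sided_0: "0 \<in> I"
    and two_sided_add: "x \<in> I \<Longrightarrow> y \<in> I \<Longrightarrow> x + y \<in> I"
    and two_sided_left: "x \<in> I \<Longrightarrow> r * x \<in> I"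
    and two_sided_right: "x \<in> I \<Longrightarrow> x * r \<in> I"
  using assms by (auto simp: two_sided_def)

lemma two_sided_minus: "two_sided I \<Longrightarrow> x \<in> I \<Longrightarrow> - x \<in> I"
  using two_sided_left[of I x "- 1"] by simp

lemma two_sided_diff: "two_sided I \<Longrightarrow> x \<in> I \<Longrightarrow> y \<in> I \<Longrightarrow> x - y \<in> I"
  using two_sided_add[of I x "- y"] two_sided_minus[of I y] by simp

text \<open>The bridge between ideals of the algebra record and the ring class operations used in
  the computations.\<close>

lemma two_sided_iff_ideal:
  "two_sided (I :: ('g, 'f::field) falg set) \<longleftrightarrow> ideal I (free_alg :: ('f, ('g, 'f) falg) module)"
proof
  interpret ring "free_alg :: ('f, ('g, 'f) falg) module" by (rule ring_free_alg)
  assume I: "two_sided I"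
  show "ideal I (free_alg :: ('f, ('g, 'f) falg) module)"
  proof (rule idealI[OF ring_free_alg])
    show "subgroup I (add_monoid (free_alg :: ('f, ('g, 'f) falg) module))"
      by (rule add.subgroupI)
        (use two_sided_0[OF I] two_sided_add[OF I] two_sided_minus[OF I] in \<open>auto simp: a_inv_def[symmetric]\<close>)
  qed (use two_sided_left[OF I] two_sided_right[OF I] in auto)
next
  assume "ideal I (free_alg :: ('f, ('g, 'f) falg) module)"
  then interpret ideal I "free_alg :: ('f, ('g, 'f) falg) module" .
  show "two_sided I"
    using additive_subgroup.a_closed[OF is_additive_subgroup] I_l_closed I_r_closed additive_subgroup.zero_closed[OF is_additive_subgroup]
    by (auto simp: two_sided_def)
qed

lemma two_sided_rel_ideal: "two_sided (rel_ideal R)"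
  using ideal_rel_ideal by (simp add: two_sided_iff_ideal)

lemma rel_ideal_incl: "(u, v) \<in> R \<Longrightarrow> u - v \<in> rel_ideal R"
  unfolding rel_ideal_def
  using ring.genideal_self[OF ring_free_alg, of "{u \<ominus>\<^bsub>free_alg\<^esub> v | u v. (u, v) \<in> R}"] by auto

lemma rel_ideal_least:
  "two_sided I \<Longrightarrow> (\<And>u v. (u, v) \<in> R \<Longrightarrow> u - v \<in> I) \<Longrightarrow> rel_ideal R \<subseteq> I"
  unfolding rel_ideal_def
  by (rule ring.genideal_minimal[OF ring_free_alg]) (auto simp: two_sided_iff_ideal)

section \<open>Substitutions: the homomorphisms of free algebras extending a map on
  generators\<close>

definition subst :: "('g \<Rightarrow> ('h, 'f::field) falg) \<Rightarrow> ('g, 'f) falg \<Rightarrow> ('h, 'f) falg" where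
  "subst s p = (\<Sum>w\<in>Poly_Mapping.keys p.
     scalar (Poly_Mapping.lookup p w) * prod_list (map s (letters w)))"

text \<open>Summing over a common finite set makes additivity a termwise identity, although the
  supports of \<open>p\<close>, \<open>r\<close> and \<open>p + r\<close> differ.\<close>

lemma subst_superset:
  assumes "finite W" "Poly_Mapping.keys p \<subseteq> W"
  shows "subst s p = (\<Sum>w\<in>W. scalar (Poly_Mapping.lookup p w) * prod_list (map s (letters w)))"
  unfolding subst_def using assms
  by (intro sum.mono_neutral_left) (auto simp: in_keys_iff)

lemma subst_add [simp]: "subst s (p + r) = subst s p + subst s r"
proof -
  let ?W = "Poly_Mapping.keys p \<union> Poly_Mapping.keys r"
  have "Poly_Mapping.keys (p + r) \<subseteq> ?W" by (rule Poly_Mapping.keys_add)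
  then show ?thesis
    by (subst (1 2 3) subst_superset[of ?W])
      (auto simp: lookup_add scalar_add distrib_right sum.distrib)
qed

lemma subst_single: "subst s (Poly_Mapping.single w c) = scalar c * prod_list (map s (letters w))"
  by (subst subst_superset[of "{w}"]) auto

lemma subst_scalar [simp]: "subst s (scalar c) = scalar c"
  by (simp add: scalar_def subst_single zero_word_def)

lemma subst_gen [simp]: "subst s (gen x) = s x"
  by (simp add: gen_def subst_single)

lemma subst_0 [simp]: "subst s 0 = 0" and subst_1 [simp]: "subst s 1 = 1"
  using subst_scalar[of s 0] subst_scalar[of s 1] by simp_all

lemma subst_minus [simp]: "subst s (- p) = - subst s p"
  using subst_add[of s p "- p"] by (simp add: eq_neg_iff_add_eq_0 add.commute)

lemma subst_diff [simp]: "subst s (p - r) = subst s p - subst s r"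
  using subst_add[of s p "- r"] by simp

lemma subst_mult [simp]: "subst s (p * r) = subst s p * subst s r"
proof (induction p rule: falg_single_induct)
  case (single w c)
  show ?case
  proof (induction r rule: falg_single_induct)
    case (single v d)
    let ?x = "prod_list (map s w)" and ?y = "prod_list (map s v)"
    have "scalar (c * d) * (?x * ?y) = scalar c * (scalar d * (?x * ?y))"
      by (simp only: scalar_mult_assoc)
    also have "\<dots> = scalar c * ?x * (scalar d * ?y)"
      by (simp only: mult_scalar[of ?x d ?y] mult.assoc)
    finally show ?case
      by (simp add: mult_single subst_single plus_word_def)
  qed (simp add: distrib_left)
qed (simp add: distrib_right)

section \<open>The relations between the alternating elements\<close>

definition generic :: "'f::field \<Rightarrow> bool" where
  "generic q \<longleftrightarrow> q \<noteq> 0 \<and> (\<forall>n>0. q ^ n \<noteq> 1)"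

text \<open>
  A type cannot depend on $q$. In order to compute in $\mathcal U$ with a type of class \<open>ring\<close>, all
  admissible $q$ are treated at once: the type \<open>U_prod\<close> is the product of the algebras $\mathcal U$
  over all these $q$.
\<close>

definition U_cong ::
    "('f::field \<Rightarrow> (compact_gen, 'f) falg) \<Rightarrow> ('f \<Rightarrow> (compact_gen, 'f) falg) \<Rightarrow> bool" where
  "U_cong F G \<longleftrightarrow> (\<forall>q. generic q \<longrightarrow> F q - G q \<in> rel_ideal (U_relations q))"

lemmas U_ideal = two_sided_rel_ideal[of "U_relations q" for q]

lemma equivp_U_cong: "equivp (U_cong :: ('f::field \<Rightarrow> (compact_gen, 'f) falg) \<Rightarrow> _)"
proof (rule equivpI)
  show "reflp (U_cong :: ('f \<Rightarrow> (compact_gen, 'f) falg) \<Rightarrow> _)"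
    by (rule reflpI) (simp add: U_cong_def two_sided_0[OF U_ideal])
  show "symp (U_cong :: ('f \<Rightarrow> (compact_gen, 'f) falg) \<Rightarrow> _)"
  proof (rule sympI)
    fix F G :: "'f \<Rightarrow> (compact_gen, 'f) falg"
    assume "U_cong F G"
    then show "U_cong G F"
      using two_sided_minus[OF U_ideal] unfolding U_cong_def by (metis minus_diff_eq)
  qed
  show "transp (U_cong :: ('f \<Rightarrow> (compact_gen, 'f) falg) \<Rightarrow> _)"
  proof (rule transpI)
    fix F G H :: "'f \<Rightarrow> (compact_gen, 'f) falg"
    assume *: "U_cong F G" "U_cong G H"
    have "(F q - G q) + (G q - H q) \<in> rel_ideal (U_relations q)" if "generic q" for q
      using * that by (intro two_sided_add[OF U_ideal]) (auto simp: U_cong_def)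
    then show "U_cong F H"
      by (simp add: U_cong_def)
  qed
qed

quotient_type (overloaded) 'f U_prod = "'f::field \<Rightarrow> (compact_gen, 'f) falg" / U_cong
  by (rule equivp_U_cong)

lemma U_congI: "(\<And>q. generic q \<Longrightarrow> F q = G q) \<Longrightarrow> U_cong F G"
  by (simp add: U_cong_def two_sided_0[OF U_ideal])

section \<open>Ring structure and scalars on the product of the algebras\<close>

instantiation U_prod :: (field) "{ring, monoid_mult}"
begin

lift_definition zero_U_prod :: "'a U_prod" is "\<lambda>_. 0" .
lift_definition one_U_prod :: "'a U_prod" is "\<lambda>_. 1" .
lift_definition plus_U_prod :: "'a U_prod \<Rightarrow> 'a U_prod \<Rightarrow> 'a U_prod" is "\<lambda>F G q. F q + G q"
proof -
  fix F F' G G' :: "'a \<Rightarrow> (compact_gen, 'a) falg"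
  assume *: "U_cong F F'" "U_cong G G'"
  show "U_cong (\<lambda>q. F q + G q) (\<lambda>q. F' q + G' q)"
    unfolding U_cong_def
  proof (intro allI impI)
    fix q :: 'a assume "generic q"
    with * have "F q - F' q \<in> rel_ideal (U_relations q)" "G q - G' q \<in> rel_ideal (U_relations q)"
      by (simp_all add: U_cong_def)
    then have "F q - F' q + (G q - G' q) \<in> rel_ideal (U_relations q)"
      by (intro two_sided_add[OF U_ideal])
    then show "F q + G q - (F' q + G' q) \<in> rel_ideal (U_relations q)"
      by (simp add: algebra_simps)
  qed
qed

lift_definition minus_U_prod :: "'a U_prod \<Rightarrow> 'a U_prod \<Rightarrow> 'a U_prod" is "\<lambda>F G q. F q - G q"
proof -
  fix F F' G G' :: "'a \<Rightarrow> (compact_gen, 'a) falg"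
  assume *: "U_cong F F'" "U_cong G G'"
  show "U_cong (\<lambda>q. F q - G q) (\<lambda>q. F' q - G' q)"
    unfolding U_cong_def
  proof (intro allI impI)
    fix q :: 'a assume "generic q"
    with * have "F q - F' q \<in> rel_ideal (U_relations q)" "G q - G' q \<in> rel_ideal (U_relations q)"
      by (simp_all add: U_cong_def)
    then have "F q - F' q - (G q - G' q) \<in> rel_ideal (U_relations q)"
      by (rule two_sided_diff[OF U_ideal])
    then show "F q - G q - (F' q - G' q) \<in> rel_ideal (U_relations q)"
      by (simp add: algebra_simps)
  qed
qed

lift_definition uminus_U_prod :: "'a U_prod \<Rightarrow> 'a U_prod" is "\<lambda>F q. - F q"
proof -
  fix F G :: "'a \<Rightarrow> (compact_gen, 'a) falg"
  assume "U_cong F G"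
  then have "- (F q - G q) \<in> rel_ideal (U_relations q)" if "generic q" for q
    using that by (intro two_sided_minus[OF U_ideal]) (simp add: U_cong_def)
  then show "U_cong (\<lambda>q. - F q) (\<lambda>q. - G q)"
    by (simp add: U_cong_def)
qed

lift_definition times_U_prod :: "'a U_prod \<Rightarrow> 'a U_prod \<Rightarrow> 'a U_prod" is "\<lambda>F G q. F q * G q"
proof -
  fix F F' G G' :: "'a \<Rightarrow> (compact_gen, 'a) falg"
  assume *: "U_cong F F'" "U_cong G G'"
  show "U_cong (\<lambda>q. F q * G q) (\<lambda>q. F' q * G' q)"
    unfolding U_cong_def
  proof (intro allI impI)
    fix q :: 'a assume "generic q"
    with * have "F q - F' q \<in> rel_ideal (U_relations q)" "G q - G' q \<in> rel_ideal (U_relations q)"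
      by (simp_all add: U_cong_def)
    then have "(F q - F' q) * G q + F' q * (G q - G' q) \<in> rel_ideal (U_relations q)"
      by (intro two_sided_add[OF U_ideal] two_sided_left[OF U_ideal] two_sided_right[OF U_ideal])
    then show "F q * G q - (F' q * G' q) \<in> rel_ideal (U_relations q)"
      by (simp add: algebra_simps)
  qed
qed

instance
  by standard (transfer, rule U_congI, simp add: algebra_simps)+

end

text \<open>The scalar is a function of q, one value for each factor; this makes multiplication by q
  itself a map on the product.\<close>

lift_definition U_scale :: "('f \<Rightarrow> 'f) \<Rightarrow> 'f::field U_prod \<Rightarrow> 'f U_prod" is
  "\<lambda>c F q. scalar (c q) * F q"
  unfolding U_cong_def
  by (auto simp: right_diff_distrib[symmetric] intro!: two_sided_left[OF U_ideal])

lemma U_scale_scale: "U_scale c (U_scale d x) = U_scale (\<lambda>q. c q * d q) x"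
  by transfer (rule U_congI, simp add: scalar_mult_assoc)

text \<open>Only generic q contribute a factor, so coefficients have to agree only there and
  denominators that are nonzero there may be cancelled.\<close>

lemma U_scale_cong: "(\<And>q. generic q \<Longrightarrow> c q = d q) \<Longrightarrow> U_scale c x = U_scale d x"
  by transfer (rule U_congI, simp)

lemma U_scale_1: "(\<And>q. generic q \<Longrightarrow> c q = 1) \<Longrightarrow> U_scale c x = x"
  by transfer (rule U_congI, simp)

lemma U_scale_mult: "U_scale c x * y = U_scale c (x * y)" "x * U_scale c y = U_scale c (x * y)"
  by (transfer, rule U_congI, simp add: mult.assoc mult_scalar)+

lemma U_scale_add: "U_scale c (x + y) = U_scale c x + U_scale c y"
  and U_scale_diff: "U_scale c (x - y) = U_scale c x - U_scale c y"
  and U_scale_diff_left: "U_scale c x - U_scale d x = U_scale (\<lambda>q. c q - d q) x"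
  by (transfer, rule U_congI, simp add: algebra_simps scalar_diff)+

lemma U_scale_commute: "U_scale c (U_scale d x) = U_scale d (U_scale c x)"
  by (simp add: U_scale_scale mult.commute)

lemma generic_nz: "generic q \<Longrightarrow> q \<noteq> 0"
  by (simp add: generic_def)

lemma generic_power: "generic q \<Longrightarrow> n > 0 \<Longrightarrow> q ^ n - (1 / q) ^ n \<noteq> 0"
proof
  assume q: "generic q" "n > 0" "q ^ n - (1 / q) ^ n = 0"
  then have "q ^ (n + n) = 1"
    by (simp add: generic_nz power_one_over power_add field_simps)
  with q show False unfolding generic_def by (metis add_gr_0)
qed

abbreviation "U_Q \<equiv> U_scale (\<lambda>q. q)"
abbreviation "U_P \<equiv> U_scale (\<lambda>q. 1 / q)"

interpretation qp: q_scaling "U_Q :: 'f::field U_prod \<Rightarrow> _" U_P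
proof
  fix n :: nat and x :: "'f U_prod"
  have pow: "(U_scale c ^^ n) x = U_scale (\<lambda>q. c q ^ n) x" for c :: "'f \<Rightarrow> 'f"
    by (induction n) (simp_all add: U_scale_1 U_scale_scale)
  assume n: "n > 0" "(U_Q ^^ n) x = (U_P ^^ n) x"
  then have *: "U_scale (\<lambda>q. q ^ n - (1 / q) ^ n) x = 0"
    by (simp add: pow U_scale_diff_left[symmetric])
  \<comment> \<open>q^n - q^-n is invertible at each generic q, so \<open>x\<close> is recovered
    from its multiple.\<close>
  have "x = U_scale (\<lambda>q. 1 / (q ^ n - (1 / q) ^ n)) (U_scale (\<lambda>q. q ^ n - (1 / q) ^ n) x)"
    unfolding U_scale_scale using generic_power[OF _ n(1)] by (intro U_scale_1[symmetric]) simp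
  also have "\<dots> = 0"
    unfolding * using U_scale_diff[of _ 0 0] by simp
  finally show "x = 0" .
qed (auto simp: U_scale_add U_scale_mult U_scale_scale intro!: U_scale_1 dest: generic_nz)

definition U_prod_of :: "('f::field \<Rightarrow> (compact_gen, 'f) falg) \<Rightarrow> 'f U_prod" where
  "U_prod_of = abs_U_prod"

lemma U_prod_of_eq_iff: "U_prod_of F = U_prod_of G \<longleftrightarrow> U_cong F G"
  by (simp add: U_prod_of_def U_prod.abs_eq_iff)

text \<open>The right sides use the operations of \<open>free_alg\<close>, so that unfolding yields
  the very terms that occur in the relation sets.\<close>

lemma U_prod_of_ops:
  "U_prod_of F + U_prod_of G = U_prod_of (\<lambda>q. F q \<oplus>\<^bsub>free_alg\<^esub> G q)"
  "U_prod_of F - U_prod_of G = U_prod_of (\<lambda>q. F q \<ominus>\<^bsub>free_alg\<^esub> G q)"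
  "U_prod_of F * U_prod_of G = U_prod_of (\<lambda>q. F q \<otimes>\<^bsub>free_alg\<^esub> G q)"
  "0 = U_prod_of (\<lambda>q. \<zero>\<^bsub>free_alg\<^esub>)"
  "1 = U_prod_of (\<lambda>q. \<one>\<^bsub>free_alg\<^esub>)"
  "U_scale c (U_prod_of F) = U_prod_of (\<lambda>q. c q \<odot>\<^bsub>free_alg\<^esub> F q)"
  by (simp_all add: U_prod_of_def plus_U_prod.abs_eq minus_U_prod.abs_eq times_U_prod.abs_eq
      zero_U_prod_def one_U_prod_def U_scale.abs_eq falg_smult)

lemma U_prod_of_cm: "qp.cm (U_prod_of F) (U_prod_of G) = U_prod_of (\<lambda>q. comm free_alg (F q) (G q))"
  by (simp add: qp.cm_def comm_def U_prod_of_ops)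

lemma U_prod_of_qc: "qp.qc (U_prod_of F) (U_prod_of G) = U_prod_of (\<lambda>q. qcomm free_alg q (F q) (G q))"
  by (simp add: qp.qc_def qcomm_def U_prod_of_ops)

lemma U_prod_of_relation:
  "(\<And>q. generic q \<Longrightarrow> (F q, G q) \<in> U_relations q) \<Longrightarrow> U_prod_of F = U_prod_of G"
  by (simp add: U_prod_of_eq_iff U_cong_def rel_ideal_incl)

section \<open>Representatives of the alternating elements in the free algebra\<close>

definition free_Gt :: "nat \<Rightarrow> (compact_gen, 'f::field) falg" where
  "free_Gt = from0 free_alg (\<lambda>k. gen (C_Gt k))"

definition free_Wn :: "'f::field \<Rightarrow> nat \<Rightarrow> (compact_gen, 'f) falg" where
  "free_Wn q k = (1 / (q - 1/q)) \<odot>\<^bsub>free_alg\<^esub> qcomm free_alg q (free_Gt k) (gen C_W0)"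

definition free_Wp :: "'f::field \<Rightarrow> nat \<Rightarrow> (compact_gen, 'f) falg" where
  "free_Wp q k = (1 / (q - 1/q)) \<odot>\<^bsub>free_alg\<^esub> qcomm free_alg q (gen C_W1) (free_Gt k)"

definition free_G :: "'f::field \<Rightarrow> nat \<Rightarrow> (compact_gen, 'f) falg" where
  "free_G q = from0 free_alg (\<lambda>k. free_Gt (k+1) \<oplus>\<^bsub>free_alg\<^esub>
     (1 / (1 - 1/q^2)) \<odot>\<^bsub>free_alg\<^esub> comm free_alg (gen C_W1) (free_Wn q k))"

abbreviation "prod_W0 \<equiv> U_prod_of (\<lambda>_. gen C_W0)"
abbreviation "prod_W1 \<equiv> U_prod_of (\<lambda>_. gen C_W1)"
abbreviation "prod_Gt k \<equiv> U_prod_of (\<lambda>_. free_Gt k)"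
abbreviation "prod_Wn k \<equiv> U_prod_of (\<lambda>q. free_Wn q k)"
abbreviation "prod_Wp k \<equiv> U_prod_of (\<lambda>q. free_Wp q k)"
abbreviation "prod_G k \<equiv> U_prod_of (\<lambda>q. free_G q k)"

lemma generic_diff: "generic q \<Longrightarrow> q - 1 / q \<noteq> 0" "generic q \<Longrightarrow> 1 - 1 / q ^ 2 \<noteq> 0"
  "generic q \<Longrightarrow> q ^ 2 - 1 / q ^ 2 \<noteq> 0"
proof -
  assume q: "generic q"
  show "q - 1 / q \<noteq> 0"
    using generic_power[OF q, of 1] by simp
  then show "1 - 1 / q ^ 2 \<noteq> 0"
    using generic_nz[OF q] by (simp add: field_simps power2_eq_square)
  show "q ^ 2 - 1 / q ^ 2 \<noteq> 0"
    using generic_power[OF q, of 2] by (simp add: power_one_over)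
qed

text \<open>Since [G~_k,W_0]_q = (q - q^-1) W_{-k}, the coefficient of the compact relations with k
  \<ge> 1 becomes q / (q^2 - q^-2), that of the relations for G~_1. The same holds on the W_1
  side.\<close>

lemma generic_factor:
  assumes "generic q"
  shows "(q^2 - 1/q^2) * (1 / ((1 - 1/q^2) * (q^2 - 1/q^2)) * (q - 1/q)) = q"
proof -
  have "q - 1/q = q * (1 - 1/q^2)"
    using generic_nz[OF assms] by (simp add: field_simps power2_eq_square)
  then show ?thesis
    using generic_diff(2,3)[OF assms] by (simp add: divide_simps)
qed

lemma U_Q_minus_P: "U_Q x - U_P x = U_scale (\<lambda>q. q - 1 / q) x"
  by (simp add: U_scale_diff_left)

lemma minus_U_P_P: "x - U_P (U_P x) = U_scale (\<lambda>q. 1 - 1 / q ^ 2) x"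
  using U_scale_diff_left[of "\<lambda>_. 1" x] by (simp add: U_scale_scale U_scale_1 power2_eq_square)

lemma U_Q_Q_minus_P_P: "U_Q (U_Q x) - U_P (U_P x) = U_scale (\<lambda>q. q ^ 2 - 1 / q ^ 2) x"
  by (simp add: U_scale_scale U_scale_diff_left power2_eq_square)

lemma prod_Wn_def: "prod_Wn k = U_scale (\<lambda>q. 1 / (q - 1 / q)) (qp.qc (prod_Gt k) prod_W0)"
  unfolding U_prod_of_qc U_prod_of_ops free_Wn_def ..

lemma prod_Wp_def: "prod_Wp k = U_scale (\<lambda>q. 1 / (q - 1 / q)) (qp.qc prod_W1 (prod_Gt k))"
  unfolding U_prod_of_qc U_prod_of_ops free_Wp_def ..

lemma prod_G_Suc:
  "prod_G (Suc k) = prod_Gt (Suc k) + U_scale (\<lambda>q. 1 / (1 - 1 / q ^ 2)) (qp.cm prod_W1 (prod_Wn k))"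
  unfolding U_prod_of_cm U_prod_of_ops free_G_def by (simp add: from0_def)

lemma U_scale_cm:
  "qp.cm (U_scale c x) y = U_scale c (qp.cm x y)"
  "qp.cm x (U_scale c y) = U_scale c (qp.cm x y)"
  by (simp_all add: qp.cm_def U_scale_mult U_scale_diff)

lemma U_scale_qc:
  "qp.qc (U_scale c x) y = U_scale c (qp.qc x y)"
  "qp.qc x (U_scale c y) = U_scale c (qp.qc x y)"
  by (simp_all add: qp.qc_def U_scale_mult U_scale_diff U_scale_commute[of c])

lemma prod_qc_Gt_W0: "qp.qc (prod_Gt k) prod_W0 = U_Q (prod_Wn k) - U_P (prod_Wn k)"
  unfolding U_Q_minus_P unfolding prod_Wn_def U_scale_scale
  by (rule U_scale_1[symmetric]) (simp add: generic_diff[simplified])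

lemma prod_qc_W1_Gt: "qp.qc prod_W1 (prod_Gt k) = U_Q (prod_Wp k) - U_P (prod_Wp k)"
  unfolding U_Q_minus_P unfolding prod_Wp_def U_scale_scale
  by (rule U_scale_1[symmetric]) (simp add: generic_diff[simplified])

lemma prod_Gt_0: "prod_Gt 0 = 1" and prod_G_0: "prod_G 0 = 1"
  by (simp_all add: free_Gt_def free_G_def from0_def U_prod_of_ops)

lemma prod_Gt_Gt: "qp.cm (prod_Gt k) (prod_Gt l) = 0"
proof (cases k; cases l)
  fix i j assume "k = Suc i" "l = Suc j"
  then show ?thesis
    unfolding U_prod_of_cm U_prod_of_ops
    by (intro U_prod_of_relation) (auto simp: U_relations_def compact_relations_def free_Gt_def)
qed (simp_all add: prod_Gt_0 qp.cm_def)

lemma prod_serre_W0: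
  "U_P (qp.cm prod_W0 (prod_W0 * qp.qc prod_W0 prod_W1))
    = U_Q (qp.cm prod_W0 (qp.qc prod_W0 prod_W1 * prod_W0))"
proof -
  have "qp.cm prod_W0 (U_P (prod_W0 * qp.qc prod_W0 prod_W1) - U_Q (qp.qc prod_W0 prod_W1 * prod_W0))
     = U_prod_of (\<lambda>q. comm free_alg (gen C_W0)
         (qcomm free_alg (1/q) (gen C_W0) (qcomm free_alg q (gen C_W0) (gen C_W1))))"
    unfolding U_prod_of_qc U_prod_of_ops U_prod_of_cm by (simp add: qcomm_def)
  also have "\<dots> = 0"
    unfolding U_prod_of_ops by (rule U_prod_of_relation) (simp add: U_relations_def compact_relations_def)
  finally show ?thesis by (simp add: qp.cm_def algebra_simps)
qed

lemma prod_serre_W1: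
  "U_P (qp.cm prod_W1 (prod_W1 * qp.qc prod_W1 prod_W0))
    = U_Q (qp.cm prod_W1 (qp.qc prod_W1 prod_W0 * prod_W1))"
proof -
  have "qp.cm prod_W1 (U_P (prod_W1 * qp.qc prod_W1 prod_W0) - U_Q (qp.qc prod_W1 prod_W0 * prod_W1))
     = U_prod_of (\<lambda>q. comm free_alg (gen C_W1)
         (qcomm free_alg (1/q) (gen C_W1) (qcomm free_alg q (gen C_W1) (gen C_W0))))"
    unfolding U_prod_of_qc U_prod_of_ops U_prod_of_cm by (simp add: qcomm_def)
  also have "\<dots> = 0"
    unfolding U_prod_of_ops by (rule U_prod_of_relation) (simp add: U_relations_def compact_relations_def)
  finally show ?thesis by (simp add: qp.cm_def algebra_simps)
qed

lemma prod_Wn_0: "prod_Wn 0 = prod_W0" and prod_Wp_0: "prod_Wp 0 = prod_W1"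
proof -
  show "prod_Wn 0 = prod_W0"
    by (rule qp.Q_minus_P_cancel) (use prod_qc_Gt_W0[of 0, symmetric] in \<open>simp add: prod_Gt_0 qp.qc_def\<close>)
  show "prod_Wp 0 = prod_W1"
    by (rule qp.Q_minus_P_cancel) (use prod_qc_W1_Gt[of 0, symmetric] in \<open>simp add: prod_Gt_0 qp.qc_def\<close>)
qed

text \<open>A common form for two kinds of compact relations: expressed through W_{-k}, those with k
  \<ge> 1 have the shape of the one for G~_1.\<close>

lemma prod_cm_Gt_W1:
  "U_Q (U_Q (qp.cm (prod_Gt (Suc k)) prod_W1)) - U_P (U_P (qp.cm (prod_Gt (Suc k)) prod_W1))
    = U_Q (qp.cm (qp.qc (prod_Wn k) prod_W1) prod_W1)"
proof (cases k)
  case 0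
  have *: "qp.cm (prod_Gt (Suc 0)) prod_W1
      = U_scale (\<lambda>q. q / (q^2 - 1/q^2)) (qp.cm (qp.qc prod_W0 prod_W1) prod_W1)"
    unfolding U_prod_of_qc U_prod_of_cm U_prod_of_ops
    by (rule U_prod_of_relation) (simp add: U_relations_def compact_relations_def free_Gt_def)
  show ?thesis
    unfolding U_Q_Q_minus_P_P unfolding 0 prod_Wn_0 * U_scale_scale
    by (rule U_scale_cong) (simp add: generic_diff[simplified])
next
  case (Suc j)
  have *: "qp.cm (prod_Gt (Suc k)) prod_W1 = U_scale (\<lambda>q. 1 / ((1 - 1/q^2) * (q^2 - 1/q^2)))
      (qp.cm (qp.qc (qp.qc (prod_Gt k) prod_W0) prod_W1) prod_W1)"
    unfolding U_prod_of_qc U_prod_of_cm U_prod_of_ops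
    by (rule U_prod_of_relation) (auto simp: U_relations_def compact_relations_def free_Gt_def Suc)
  show ?thesis
    unfolding U_Q_Q_minus_P_P * unfolding prod_qc_Gt_W0 U_Q_minus_P U_scale_qc U_scale_cm U_scale_scale
    by (rule U_scale_cong) (rule generic_factor)
qed

lemma prod_cm_W0_Gt:
  "U_Q (U_Q (qp.cm prod_W0 (prod_Gt (Suc k)))) - U_P (U_P (qp.cm prod_W0 (prod_Gt (Suc k))))
    = U_Q (qp.cm prod_W0 (qp.qc prod_W0 (prod_Wp k)))"
proof (cases k)
  case 0
  have *: "qp.cm prod_W0 (prod_Gt (Suc 0))
      = U_scale (\<lambda>q. q / (q^2 - 1/q^2)) (qp.cm prod_W0 (qp.qc prod_W0 prod_W1))"
    unfolding U_prod_of_qc U_prod_of_cm U_prod_of_ops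
    by (rule U_prod_of_relation) (simp add: U_relations_def compact_relations_def free_Gt_def)
  show ?thesis
    unfolding U_Q_Q_minus_P_P unfolding 0 prod_Wp_0 * U_scale_scale
    by (rule U_scale_cong) (simp add: generic_diff[simplified])
next
  case (Suc j)
  have *: "qp.cm prod_W0 (prod_Gt (Suc k)) = U_scale (\<lambda>q. 1 / ((1 - 1/q^2) * (q^2 - 1/q^2)))
      (qp.cm prod_W0 (qp.qc prod_W0 (qp.qc prod_W1 (prod_Gt k))))"
    unfolding U_prod_of_qc U_prod_of_cm U_prod_of_ops
    by (rule U_prod_of_relation) (auto simp: U_relations_def compact_relations_def free_Gt_def Suc)
  show ?thesis
    unfolding U_Q_Q_minus_P_P * unfolding prod_qc_W1_Gt U_Q_minus_P U_scale_qc U_scale_cm U_scale_scale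
    by (rule U_scale_cong) (rule generic_factor)
qed

interpretation U_fam: compact_family U_Q U_P prod_W0 prod_W1 prod_Gt prod_Wn prod_Wp prod_G
proof
  show "(prod_G (Suc k) - prod_Gt (Suc k)) - U_P (U_P (prod_G (Suc k) - prod_Gt (Suc k)))
      = qp.cm prod_W1 (prod_Wn k)" for k
    unfolding minus_U_P_P prod_G_Suc
    by (simp add: U_scale_scale) (rule U_scale_1, simp add: generic_diff[simplified])
qed (fact prod_Gt_0 prod_G_0 prod_Gt_Gt prod_qc_Gt_W0 prod_qc_W1_Gt prod_serre_W0 prod_serre_W1 prod_cm_Gt_W1 prod_cm_W0_Gt)+

lemma U_prod_of_eqD: "U_prod_of F = U_prod_of H \<Longrightarrow> generic q \<Longrightarrow> F q - H q \<in> rel_ideal (U_relations q)"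
  by (simp add: U_prod_of_eq_iff U_cong_def)

lemma alternating_relations_hold:
  assumes q: "generic q"
    and uv: "(u, v) \<in> alternating_relations free_alg q (free_Wn q) (free_Wp q) (free_G q) free_Gt"
  shows "u - v \<in> rel_ideal (U_relations q)"
proof -
  note rels = U_fam.alternating.cm_A_b U_fam.alternating.cm_a_B
    U_fam.alternating.qc_A_h[folded U_fam.alternating.qc_g_A] U_fam.alternating.qc_g_A
    U_fam.alternating.qc_h_B[folded U_fam.alternating.qc_B_g] U_fam.alternating.qc_B_g
    U_fam.alternating.cm_a_a U_fam.alternating.cm_b_b U_fam.alternating.a_b_comm
    U_fam.alternating.a_h_comm' U_fam.alternating.a_g_comm' U_fam.alternating.b_h_comm' U_fam.alternating.b_g_comm'
    U_fam.alternating.hh' U_fam.alternating.gg U_fam.alternating.gh_hg_comm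
    U_fam.alternating.a_h' U_fam.alternating.h_b' U_fam.alternating.g_a U_fam.alternating.b_g
    U_fam.alternating.g_h_comm U_fam.alternating.h_g_comm' U_fam.alternating.h_g_qc' U_fam.alternating.g_h_qc'
  \<comment> \<open>Back from the product to one q: W_0 and W_1 become members of their families,
    scalars are merged into the coefficients of the relations, and equality in the product is read
    off at the given q.\<close>
  note r = rels[folded prod_Wn_0 prod_Wp_0,
      unfolded minus_U_P_P, unfolded U_Q_minus_P, unfolded U_prod_of_cm U_prod_of_qc, unfolded U_prod_of_ops,
      THEN U_prod_of_eqD, OF q]
  show ?thesis using uv
    unfolding alternating_relations_def Suc_eq_plus1[symmetric]
    by (elim UN_E) (simp only: insert_iff empty_iff prod.inject simp_thms, elim disjE conjE; simp only: r)
qed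

section \<open>The compact relations as consequences of the alternating relations\<close>

definition scale :: "'f::field \<Rightarrow> ('g, 'f) falg \<Rightarrow> ('g, 'f) falg" where
  "scale c x = scalar c * x"

lemma scale_simps [simp]:
  "scale c x * y = scale c (x * y)" "x * scale c y = scale c (x * y)"
  "scale c (scale d x) = scale (c * d) x" "scale c (x + y) = scale c x + scale c y"
  "scale c (x - y) = scale c x - scale c y" "scale c (- x) = - scale c x" "scale 1 x = x" "scale c 0 = 0"
  by (simp_all add: scale_def mult.assoc mult_scalar[of x c y] scalar_mult_assoc distrib_left right_diff_distrib)

lemma scale_add_left: "scale (c + d) x = scale c x + scale d x"
  by (simp add: scale_def scalar_add distrib_right)

lemma free_alg_scale: "c \<odot>\<^bsub>free_alg\<^esub> x = scale c x"
  "qcomm free_alg q x y = scale q (x * y) - scale (1 / q) (y * x)"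
  by (simp_all add: qcomm_def scale_def falg_smult)

lemmas free_alg_simps = free_alg_scale comm_free_alg falg_minus falg_ops(2-5)

lemma comm_scale:
  "comm free_alg (scale c x) y = scale c (comm free_alg x y)"
  "comm free_alg x (scale c y) = scale c (comm free_alg x y)"
  by (simp_all add: comm_free_alg)

lemma qcomm_scale:
  "qcomm free_alg q (scale c x) y = scale c (qcomm free_alg q x y)"
  "qcomm free_alg q x (scale c y) = scale c (qcomm free_alg q x y)"
  by (simp_all add: free_alg_scale mult.commute)

locale alternating_ideal =
  fixes q :: "'f::field" and I :: "('g, 'f) falg set"
    and Wn Wp G Gt :: "nat \<Rightarrow> ('g, 'f) falg"
  assumes q: "generic q" and I: "two_sided I"
    and G_0: "G 0 = 1" and Gt_0: "Gt 0 = 1"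
    and rel: "(u, v) \<in> alternating_relations free_alg q Wn Wp G Gt \<Longrightarrow> u - v \<in> I"
begin

definition eqv :: "('g, 'f) falg \<Rightarrow> ('g, 'f) falg \<Rightarrow> bool" (infix "\<approx>" 50) where
  "u \<approx> v \<longleftrightarrow> u - v \<in> I"

lemma eqv_refl [simp]: "u \<approx> u"
  by (simp add: eqv_def two_sided_0[OF I])

lemma eqv_sym: "u \<approx> v \<Longrightarrow> v \<approx> u"
  using two_sided_minus[OF I, of "u - v"] by (simp add: eqv_def)

lemma eqv_trans [trans]: "u \<approx> v \<Longrightarrow> v \<approx> w \<Longrightarrow> u \<approx> w"
  using two_sided_add[OF I, of "u - v" "v - w"] by (simp add: eqv_def)

lemma eqv_add: "u \<approx> u' \<Longrightarrow> v \<approx> v' \<Longrightarrow> u + v \<approx> u' + v'"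
  using two_sided_add[OF I, of "u - u'" "v - v'"] by (simp add: eqv_def algebra_simps)

lemma eqv_diff: "u \<approx> u' \<Longrightarrow> v \<approx> v' \<Longrightarrow> u - v \<approx> u' - v'"
  using two_sided_diff[OF I, of "u - u'" "v - v'"] by (simp add: eqv_def algebra_simps)

lemma eqv_mult: "u \<approx> u' \<Longrightarrow> v \<approx> v' \<Longrightarrow> u * v \<approx> u' * v'"
  using two_sided_add[OF I two_sided_right[OF I, of "u - u'" v] two_sided_left[OF I, of "v - v'" u']]
  by (simp add: eqv_def algebra_simps)

lemma eqv_scale: "u \<approx> u' \<Longrightarrow> scale c u \<approx> scale c u'"
  unfolding scale_def by (simp add: eqv_mult)

lemma eqv_comm: "u \<approx> u' \<Longrightarrow> v \<approx> v' \<Longrightarrow> comm free_alg u v \<approx> comm free_alg u' v'"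
  by (simp add: comm_free_alg eqv_diff eqv_mult)

lemma eqv_qcomm: "u \<approx> u' \<Longrightarrow> v \<approx> v' \<Longrightarrow> qcomm free_alg c u v \<approx> qcomm free_alg c u' v'"
  by (simp add: free_alg_scale eqv_diff eqv_mult eqv_scale)

lemma relI: "(u, v) \<in> alternating_relations free_alg q Wn Wp G Gt \<Longrightarrow> u \<approx> v"
  by (simp add: rel eqv_def)

lemma
  shows comm_W0_Wp: "comm free_alg (Wn 0) (Wp k) \<approx> comm free_alg (Wn k) (Wp 0)"
    and comm_Wn_W1: "comm free_alg (Wn k) (Wp 0) \<approx> scale (1 - 1/q^2) (Gt (Suc k) - G (Suc k))"
    and qcomm_W0_G: "qcomm free_alg q (Wn 0) (G (Suc k)) \<approx> qcomm free_alg q (Gt (Suc k)) (Wn 0)"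
    and qcomm_Gt_W0_Suc: "qcomm free_alg q (Gt (Suc k)) (Wn 0) \<approx> scale (q - 1/q) (Wn (Suc k))"
    and qcomm_G_W1: "qcomm free_alg q (G (Suc k)) (Wp 0) \<approx> qcomm free_alg q (Wp 0) (Gt (Suc k))"
    and qcomm_W1_Gt_Suc: "qcomm free_alg q (Wp 0) (Gt (Suc k)) \<approx> scale (q - 1/q) (Wp (Suc k))"
    and comm_Wn_Wn: "comm free_alg (Wn k) (Wn l) \<approx> 0"
    and comm_Wp_Wp: "comm free_alg (Wp k) (Wp l) \<approx> 0"
    and comm_Gt_Gt: "comm free_alg (Gt (Suc k)) (Gt (Suc l)) \<approx> 0"
  by (rule relI, unfold alternating_relations_def, intro UN_I[of k] UN_I[of l] UNIV_I,
      simp only: free_alg_scale(1) falg_minus falg_ops(2-5) Suc_eq_plus1 insert_iff prod.inject simp_thms)+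

lemma q_nz: "q \<noteq> 0"
  using q by (rule generic_nz)

lemma qcomm_Gt_W0: "qcomm free_alg q (Gt k) (Wn 0) \<approx> scale (q - 1/q) (Wn k)"
  using qcomm_Gt_W0_Suc scale_add_left[of "q - 1/q" "1/q" "Wn 0"]
  by (cases k) (simp_all add: Gt_0 free_alg_scale)

lemma qcomm_W1_Gt: "qcomm free_alg q (Wp 0) (Gt k) \<approx> scale (q - 1/q) (Wp k)"
  using qcomm_W1_Gt_Suc scale_add_left[of "q - 1/q" "1/q" "Wp 0"]
  by (cases k) (simp_all add: Gt_0 free_alg_scale)

lemma Wn_eqv: "scale (1 / (q - 1/q)) (qcomm free_alg q (Gt k) (Wn 0)) \<approx> Wn k"
  using eqv_scale[OF qcomm_Gt_W0[of k], of "1 / (q - 1/q)"] generic_diff[OF q] by simp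

lemma Wp_eqv: "scale (1 / (q - 1/q)) (qcomm free_alg q (Wp 0) (Gt k)) \<approx> Wp k"
  using eqv_scale[OF qcomm_W1_Gt[of k], of "1 / (q - 1/q)"] generic_diff[OF q] by simp

lemma G_eqv: "Gt (Suc k) + scale (1 / (1 - 1/q^2)) (comm free_alg (Wp 0) (Wn k)) \<approx> G (Suc k)"
proof -
  have "Gt (Suc k) + scale (1 / (1 - 1/q^2)) (comm free_alg (Wp 0) (Wn k))
      = Gt (Suc k) - scale (1 / (1 - 1/q^2)) (comm free_alg (Wn k) (Wp 0))"
    by (simp add: comm_free_alg)
  also have "\<dots> \<approx> Gt (Suc k) - scale (1 / (1 - 1/q^2)) (scale (1 - 1/q^2) (Gt (Suc k) - G (Suc k)))"
    by (intro eqv_diff eqv_refl eqv_scale comm_Wn_W1)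
  also have "\<dots> = G (Suc k)"
    using generic_diff(2)[OF q] q_nz by simp
  finally show ?thesis .
qed

text \<open>The inverse of the coefficient q / (q^2 - q^-2) of the compact relations, in the
  factored form in which it arises.\<close>

definition r where "r = (1 - 1/q^2) * (q + 1/q)"

lemma r_eq: "r = (q^2 - 1/q^2) / q"
  using q_nz by (simp add: r_def field_simps power2_eq_square)

text \<open>The commutator and the q-commutator with W_1 can be exchanged, so that [W_{-k},W_1] can
  be replaced by a multiple of G~ - G. Turning the G part around by \<open>qcomm_G_W1\<close> leaves
  (q + q^-1)[G~,W_1].\<close>

lemma comm_qcomm_W1:
  "comm free_alg (qcomm free_alg q (Wn k) (Wp 0)) (Wp 0) \<approx> scale r (comm free_alg (Gt (Suc k)) (Wp 0))"
proof -
  have "comm free_alg (qcomm free_alg q (Wn k) (Wp 0)) (Wp 0)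
      = qcomm free_alg q (comm free_alg (Wn k) (Wp 0)) (Wp 0)"
    by (simp add: free_alg_simps algebra_simps)
  also have "\<dots> \<approx> qcomm free_alg q (scale (1 - 1/q^2) (Gt (Suc k) - G (Suc k))) (Wp 0)"
    by (intro eqv_qcomm comm_Wn_W1 eqv_refl)
  also have "\<dots> = scale (1 - 1/q^2) (qcomm free_alg q (Gt (Suc k)) (Wp 0) - qcomm free_alg q (G (Suc k)) (Wp 0))"
    by (simp add: free_alg_simps algebra_simps)
  also have "\<dots> \<approx> scale (1 - 1/q^2) (qcomm free_alg q (Gt (Suc k)) (Wp 0) - qcomm free_alg q (Wp 0) (Gt (Suc k)))"
    by (intro eqv_scale eqv_diff eqv_refl qcomm_G_W1)
  also have "\<dots> = scale (1 - 1/q^2) (scale (q + 1/q) (comm free_alg (Gt (Suc k)) (Wp 0)))"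
    by (simp add: free_alg_simps scale_add_left algebra_simps del: scale_simps(3))
  also have "\<dots> = scale r (comm free_alg (Gt (Suc k)) (Wp 0))"
    by (simp only: scale_simps(3) r_def)
  finally show ?thesis .
qed

lemma comm_qcomm_W0:
  "comm free_alg (Wn 0) (qcomm free_alg q (Wn 0) (Wp k)) \<approx> scale r (comm free_alg (Wn 0) (Gt (Suc k)))"
proof -
  have "comm free_alg (Wn 0) (qcomm free_alg q (Wn 0) (Wp k))
      = qcomm free_alg q (Wn 0) (comm free_alg (Wn 0) (Wp k))"
    by (simp add: free_alg_simps algebra_simps)
  also have "\<dots> \<approx> qcomm free_alg q (Wn 0) (scale (1 - 1/q^2) (Gt (Suc k) - G (Suc k)))"
    by (intro eqv_qcomm eqv_refl eqv_trans[OF comm_W0_Wp comm_Wn_W1])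
  also have "\<dots> = scale (1 - 1/q^2) (qcomm free_alg q (Wn 0) (Gt (Suc k)) - qcomm free_alg q (Wn 0) (G (Suc k)))"
    by (simp add: free_alg_simps algebra_simps)
  also have "\<dots> \<approx> scale (1 - 1/q^2) (qcomm free_alg q (Wn 0) (Gt (Suc k)) - qcomm free_alg q (Gt (Suc k)) (Wn 0))"
    by (intro eqv_scale eqv_diff eqv_refl qcomm_W0_G)
  also have "\<dots> = scale (1 - 1/q^2) (scale (q + 1/q) (comm free_alg (Wn 0) (Gt (Suc k))))"
    by (simp add: free_alg_simps scale_add_left algebra_simps del: scale_simps(3))
  also have "\<dots> = scale r (comm free_alg (Wn 0) (Gt (Suc k)))"
    by (simp only: scale_simps(3) r_def)
  finally show ?thesis .
qed

text \<open>The inner double commutator is traded for one with G~_1, and this in turn for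
  [W_0,W_{-1}], which vanishes modulo the ideal.\<close>

lemma serre_eqv_W0:
  "comm free_alg (Wn 0) (qcomm free_alg (1/q) (Wn 0) (qcomm free_alg q (Wn 0) (Wp 0))) \<approx> 0"
proof -
  have "comm free_alg (Wn 0) (qcomm free_alg (1/q) (Wn 0) (qcomm free_alg q (Wn 0) (Wp 0)))
      = qcomm free_alg (1/q) (Wn 0) (comm free_alg (Wn 0) (qcomm free_alg q (Wn 0) (Wp 0)))"
    by (simp add: free_alg_simps algebra_simps)
  also have "\<dots> \<approx> qcomm free_alg (1/q) (Wn 0) (scale r (comm free_alg (Wn 0) (Gt (Suc 0))))"
    by (intro eqv_qcomm eqv_refl comm_qcomm_W0)
  also have "\<dots> = - scale r (comm free_alg (Wn 0) (qcomm free_alg q (Gt (Suc 0)) (Wn 0)))"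
    by (simp add: free_alg_simps algebra_simps)
  also have "\<dots> = 0 - scale r (comm free_alg (Wn 0) (qcomm free_alg q (Gt (Suc 0)) (Wn 0)))"
    by simp
  also have "\<dots> \<approx> 0 - scale r (comm free_alg (Wn 0) (scale (q - 1/q) (Wn (Suc 0))))"
    by (intro eqv_diff eqv_scale eqv_comm eqv_refl qcomm_Gt_W0)
  also have "\<dots> = 0 - scale (r * (q - 1/q)) (comm free_alg (Wn 0) (Wn (Suc 0)))"
    by (simp add: free_alg_simps)
  also have "\<dots> \<approx> 0 - scale (r * (q - 1/q)) 0"
    by (intro eqv_diff eqv_scale eqv_refl comm_Wn_Wn)
  finally show ?thesis by simp
qed

lemma serre_eqv_W1:
  "comm free_alg (Wp 0) (qcomm free_alg (1/q) (Wp 0) (qcomm free_alg q (Wp 0) (Wn 0))) \<approx> 0"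
proof -
  have "comm free_alg (Wp 0) (qcomm free_alg (1/q) (Wp 0) (qcomm free_alg q (Wp 0) (Wn 0)))
      = qcomm free_alg q (Wp 0) (comm free_alg (qcomm free_alg q (Wn 0) (Wp 0)) (Wp 0))"
    by (simp add: free_alg_simps algebra_simps)
  also have "\<dots> \<approx> qcomm free_alg q (Wp 0) (scale r (comm free_alg (Gt (Suc 0)) (Wp 0)))"
    by (intro eqv_qcomm eqv_refl comm_qcomm_W1)
  also have "\<dots> = 0 - scale r (comm free_alg (Wp 0) (qcomm free_alg q (Wp 0) (Gt (Suc 0))))"
    by (simp add: free_alg_simps algebra_simps)
  also have "\<dots> \<approx> 0 - scale r (comm free_alg (Wp 0) (scale (q - 1/q) (Wp (Suc 0))))"
    by (intro eqv_diff eqv_scale eqv_comm eqv_refl qcomm_W1_Gt)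
  also have "\<dots> = 0 - scale (r * (q - 1/q)) (comm free_alg (Wp 0) (Wp (Suc 0)))"
    by (simp add: free_alg_simps)
  also have "\<dots> \<approx> 0 - scale (r * (q - 1/q)) 0"
    by (intro eqv_diff eqv_scale eqv_refl comm_Wp_Wp)
  finally show ?thesis by simp
qed

lemma scale_cancel: "u \<approx> scale c v \<Longrightarrow> d * c = 1 \<Longrightarrow> v \<approx> scale d u"
  using eqv_scale[of u "scale c v" d] by (auto intro: eqv_sym)

lemma comm_Gt_W1_eqv_Wn: "comm free_alg (Gt (Suc k)) (Wp 0)
    \<approx> scale (q / (q^2 - 1/q^2)) (comm free_alg (qcomm free_alg q (Wn k) (Wp 0)) (Wp 0))"
  by (rule scale_cancel[OF comm_qcomm_W1]) (use q_nz generic_diff[OF q] in \<open>simp add: r_eq\<close>)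

lemma comm_W0_Gt_eqv_Wp: "comm free_alg (Wn 0) (Gt (Suc k))
    \<approx> scale (q / (q^2 - 1/q^2)) (comm free_alg (Wn 0) (qcomm free_alg q (Wn 0) (Wp k)))"
  by (rule scale_cancel[OF comm_qcomm_W0]) (use q_nz generic_diff[OF q] in \<open>simp add: r_eq\<close>)

lemma coeff: "q / (q^2 - 1/q^2) * (1 / (q - 1/q)) = 1 / ((1 - 1/q^2) * (q^2 - 1/q^2))"
proof -
  have "q - 1/q = q * (1 - 1/q^2)"
    using q_nz by (simp add: field_simps power2_eq_square)
  then show ?thesis using q_nz by simp
qed

lemma comm_Gt_W1_eqv_Gt: "comm free_alg (Gt (Suc k)) (Wp 0)
    \<approx> scale (1 / ((1 - 1/q^2) * (q^2 - 1/q^2)))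
        (comm free_alg (qcomm free_alg q (qcomm free_alg q (Gt k) (Wn 0)) (Wp 0)) (Wp 0))"
proof -
  note comm_Gt_W1_eqv_Wn
  also have "scale (q / (q^2 - 1/q^2)) (comm free_alg (qcomm free_alg q (Wn k) (Wp 0)) (Wp 0))
    \<approx> scale (q / (q^2 - 1/q^2)) (comm free_alg (qcomm free_alg q
        (scale (1 / (q - 1/q)) (qcomm free_alg q (Gt k) (Wn 0))) (Wp 0)) (Wp 0))"
    by (intro eqv_scale eqv_comm eqv_qcomm eqv_refl eqv_sym[OF Wn_eqv])
  also have "\<dots> = scale (q / (q^2 - 1/q^2)) (scale (1 / (q - 1/q))
     (comm free_alg (qcomm free_alg q (qcomm free_alg q (Gt k) (Wn 0)) (Wp 0)) (Wp 0)))"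
    by (simp only: comm_scale qcomm_scale)
  finally show ?thesis unfolding scale_simps(3) coeff .
qed

lemma comm_W0_Gt_eqv_Gt: "comm free_alg (Wn 0) (Gt (Suc k))
    \<approx> scale (1 / ((1 - 1/q^2) * (q^2 - 1/q^2)))
        (comm free_alg (Wn 0) (qcomm free_alg q (Wn 0) (qcomm free_alg q (Wp 0) (Gt k))))"
proof -
  note comm_W0_Gt_eqv_Wp
  also have "scale (q / (q^2 - 1/q^2)) (comm free_alg (Wn 0) (qcomm free_alg q (Wn 0) (Wp k)))
    \<approx> scale (q / (q^2 - 1/q^2)) (comm free_alg (Wn 0) (qcomm free_alg q (Wn 0)
        (scale (1 / (q - 1/q)) (qcomm free_alg q (Wp 0) (Gt k)))))"
    by (intro eqv_scale eqv_comm eqv_qcomm eqv_refl eqv_sym[OF Wp_eqv])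
  also have "\<dots> = scale (q / (q^2 - 1/q^2)) (scale (1 / (q - 1/q))
     (comm free_alg (Wn 0) (qcomm free_alg q (Wn 0) (qcomm free_alg q (Wp 0) (Gt k)))))"
    by (simp only: comm_scale qcomm_scale)
  finally show ?thesis unfolding scale_simps(3) coeff .
qed

lemma compact_relations_eqv:
  "(u, v) \<in> compact_relations free_alg q (Wn 0) (Wp 0) Gt \<Longrightarrow> u \<approx> v"
  unfolding compact_relations_def
  using serre_eqv_W0 serre_eqv_W1 comm_Gt_W1_eqv_Wn[of 0] comm_W0_Gt_eqv_Wp[of 0] comm_Gt_W1_eqv_Gt comm_W0_Gt_eqv_Gt comm_Gt_Gt
  by (auto simp: free_alg_scale(1))

end

section \<open>Images of the relation sets under substitutions\<close>

lemma subst_falg_ops: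
  "subst s (comm free_alg x y) = comm free_alg (subst s x) (subst s y)"
  "subst s (qcomm free_alg q x y) = qcomm free_alg q (subst s x) (subst s y)"
  "subst s (c \<odot>\<^bsub>free_alg\<^esub> x) = c \<odot>\<^bsub>free_alg\<^esub> subst s x"
  "subst s (x \<oplus>\<^bsub>free_alg\<^esub> y) = subst s x \<oplus>\<^bsub>free_alg\<^esub> subst s y"
  "subst s (x \<ominus>\<^bsub>free_alg\<^esub> y) = subst s x \<ominus>\<^bsub>free_alg\<^esub> subst s y"
  "subst s \<zero>\<^bsub>free_alg\<^esub> = \<zero>\<^bsub>free_alg\<^esub>"
  by (simp_all add: comm_def qcomm_def falg_smult)

lemma subst_scale [simp]: "subst s (scale c x) = scale c (subst s x)"
  by (simp add: scale_def)

lemma subst_from0: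
  "subst s (from0 free_alg f k) = from0 free_alg (\<lambda>k. subst s (f k)) k"
  by (simp add: from0_def split: nat.split)

lemma subst_alternating_relations:
  assumes "(u, v) \<in> alternating_relations free_alg q Wn Wp G Gt"
  shows "(subst s u, subst s v) \<in> alternating_relations free_alg q
    (\<lambda>k. subst s (Wn k)) (\<lambda>k. subst s (Wp k)) (\<lambda>k. subst s (G k)) (\<lambda>k. subst s (Gt k))"
proof -
  show ?thesis
    using assms unfolding alternating_relations_def
    apply (elim UN_E)
    subgoal for k l
      by (intro UN_I[of k] UN_I[of l] UNIV_I)
        (simp only: insert_iff empty_iff prod.inject simp_thms, elim disjE conjE; simp only: subst_falg_ops simp_thms)
    done
qed

lemma subst_compact_relations:
  assumes "(u, v) \<in> compact_relations free_alg q W0 W1 Gt"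
  shows "(subst s u, subst s v) \<in> compact_relations free_alg q
    (subst s W0) (subst s W1) (\<lambda>k. subst s (Gt k))"
  using assms unfolding compact_relations_def
  apply (elim UnE UN_E)
  subgoal
    by (rule UnI1, rule UnI1)
      (simp only: insert_iff empty_iff prod.inject simp_thms, elim disjE conjE; simp only: subst_falg_ops simp_thms)
  subgoal for k
    by (rule UnI1, rule UnI2, rule UN_I[of k], assumption)
      (simp only: insert_iff empty_iff prod.inject simp_thms, elim disjE conjE; simp only: subst_falg_ops simp_thms)
  subgoal for k l
    by (rule UnI2, intro UN_I[of k] UN_I[of l] UNIV_I)
      (simp only: insert_iff empty_iff prod.inject simp_thms subst_falg_ops)
  done

section \<open>The two substitutions and the correspondence of the ideals\<close>

primrec alt_to_compact :: "'f::field \<Rightarrow> alt_gen \<Rightarrow> (compact_gen, 'f) falg" where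
  "alt_to_compact q (A_Wn k) = free_Wn q k"
| "alt_to_compact q (A_Wp k) = free_Wp q k"
| "alt_to_compact q (A_G k) = free_G q (k+1)"
| "alt_to_compact q (A_Gt k) = free_Gt (k+1)"

primrec compact_to_alt :: "compact_gen \<Rightarrow> (alt_gen, 'f::field) falg" where
  "compact_to_alt C_W0 = gen (A_Wn 0)"
| "compact_to_alt C_W1 = gen (A_Wp 0)"
| "compact_to_alt (C_Gt k) = gen (A_Gt k)"

lemma from0_shift: "f 0 = \<one>\<^bsub>A\<^esub> \<Longrightarrow> from0 A (\<lambda>k. f (Suc k)) = f"
  by (rule ext) (simp add: from0_def split: nat.split)

lemma free_Gt_0: "free_Gt 0 = 1" and free_G_0: "free_G q 0 = 1"
  by (simp_all add: free_Gt_def free_G_def from0_def)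

lemma alt_to_compact_relations:
  fixes q :: "'f::field"
  assumes q: "generic q" and uv: "(u, v) \<in> alt_relations q"
  shows "subst (alt_to_compact q) (u - v) \<in> rel_ideal (U_relations q)"
proof -
  have "from0 free_alg (\<lambda>k. free_Gt (Suc k)) = (free_Gt :: nat \<Rightarrow> (compact_gen, 'f) falg)"
    "from0 free_alg (\<lambda>k. free_G q (Suc k)) = free_G q"
    by (simp_all add: from0_shift free_Gt_0 free_G_0)
  then show ?thesis
    using subst_alternating_relations[OF uv[unfolded alt_relations_def], of "alt_to_compact q"]
      alternating_relations_hold[OF q]
    by (simp add: subst_from0)
qed

lemma two_sided_subst_vimage:
  "two_sided I \<Longrightarrow> two_sided {x. subst s x \<in> I}"
  by (simp add: two_sided_def)

context
  fixes q :: "'f::field"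
  assumes q: "generic q"
begin

interpretation A: alternating_ideal q "rel_ideal (alt_relations q)" "\<lambda>k. gen (A_Wn k)" "\<lambda>k. gen (A_Wp k)"
   "from0 free_alg (\<lambda>k. gen (A_G k))" "from0 free_alg (\<lambda>k. gen (A_Gt k))"
  by unfold_locales (use q in \<open>auto simp: two_sided_rel_ideal from0_def alt_relations_def intro!: rel_ideal_incl\<close>)

lemma compact_to_alt_relations:
  assumes uv: "(u, v) \<in> U_relations q"
  shows "subst compact_to_alt (u - v) \<in> rel_ideal (alt_relations q)"
  using subst_compact_relations[OF uv[unfolded U_relations_def], of compact_to_alt]
    A.compact_relations_eqv
  by (simp add: subst_from0 A.eqv_def)

lemma subst_free_Gt: "subst compact_to_alt (free_Gt k) = from0 free_alg (\<lambda>k. gen (A_Gt k)) k"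
  by (simp add: free_Gt_def subst_from0)

text \<open>An equality in the free algebra itself: at k = 0 the formulas for W_{-k} and W_{k+1}
  reduce exactly to the generators. Surjectivity in the theorem rests on it.\<close>

lemma compact_alt_compact: "subst (alt_to_compact q) (subst compact_to_alt p) = p"
proof (induction p rule: falg_induct)
  case (gen x)
  have "scale q y - scale (1 / q) y = scale (q - 1 / q) y" for y :: "(compact_gen, 'f) falg"
    using scale_add_left[of "q - 1 / q" "1 / q" y] by simp
  then have "free_Wn q 0 = gen C_W0" "free_Wp q 0 = gen C_W1"
    using generic_diff(1)[OF q] by (simp_all add: free_Wn_def free_Wp_def free_Gt_0 free_alg_scale)
  then show ?case by (cases x) (simp_all add: free_Gt_def from0_def)
qed simp_all

text \<open>In this order the generators W_{-k}, W_{k+1} and G_{k+1} come back as their defining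
  formulas, which equal them only modulo the ideal.\<close>

lemma alt_compact_alt:
  "subst compact_to_alt (subst (alt_to_compact q) p) - p \<in> rel_ideal (alt_relations q)"
proof -
  have "A.eqv (subst compact_to_alt (subst (alt_to_compact q) p)) p"
  proof (induction p rule: falg_induct)
    case (gen x)
    have Wn: "subst compact_to_alt (free_Wn q k)
        = scale (1 / (q - 1/q)) (qcomm free_alg q (from0 free_alg (\<lambda>k. gen (A_Gt k)) k) (gen (A_Wn 0)))" for k
      by (simp add: free_Wn_def subst_falg_ops subst_free_Gt free_alg_scale(1))
    have Wp: "subst compact_to_alt (free_Wp q k)
        = scale (1 / (q - 1/q)) (qcomm free_alg q (gen (A_Wp 0)) (from0 free_alg (\<lambda>k. gen (A_Gt k)) k))" for k
      by (simp add: free_Wp_def subst_falg_ops subst_free_Gt free_alg_scale(1))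
    show ?case
    proof (cases x)
      case (A_Wn k)
      then show ?thesis using A.Wn_eqv[of k] by (simp add: Wn)
    next
      case (A_Wp k)
      then show ?thesis using A.Wp_eqv[of k] by (simp add: Wp)
    next
      case (A_G k)
      have "free_G q (Suc k) = free_Gt (Suc k)
          + scale (1 / (1 - 1/q^2)) (comm free_alg (gen C_W1) (free_Wn q k))"
        by (simp add: free_G_def from0_def free_alg_scale(1))
      then have "subst compact_to_alt (free_G q (Suc k)) = subst compact_to_alt (free_Gt (Suc k))
          + scale (1 / (1 - 1/q^2)) (comm free_alg (gen (A_Wp 0)) (subst compact_to_alt (free_Wn q k)))"
        by (simp add: subst_falg_ops)
      also have "A.eqv \<dots> (subst compact_to_alt (free_Gt (Suc k))
          + scale (1 / (1 - 1/q^2)) (comm free_alg (gen (A_Wp 0)) (gen (A_Wn k))))"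
        unfolding Wn by (intro A.eqv_add A.eqv_refl A.eqv_scale A.eqv_comm A.Wn_eqv)
      also have "A.eqv \<dots> (gen (A_G k))"
        using A.G_eqv[of k] by (simp add: subst_free_Gt from0_def)
      finally show ?thesis using A_G by simp
    next
      case (A_Gt k)
      then show ?thesis by (simp add: subst_free_Gt from0_def)
    qed
  qed (simp_all add: A.eqv_add A.eqv_mult)
  then show ?thesis by (simp add: A.eqv_def)
qed

text \<open>Each substitution maps one ideal into the other, and \<open>p\<close> is congruent to
  its image under the round trip.\<close>

lemma subst_alt_mem_iff:
  "subst (alt_to_compact q) p \<in> rel_ideal (U_relations q) \<longleftrightarrow> p \<in> rel_ideal (alt_relations q)"
proof
  have "rel_ideal (alt_relations q) \<subseteq> {p. subst (alt_to_compact q) p \<in> rel_ideal (U_relations q)}"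
    by (rule rel_ideal_least[OF two_sided_subst_vimage[OF two_sided_rel_ideal]])
      (simp add: alt_to_compact_relations[OF q] del: subst_diff)
  then show "p \<in> rel_ideal (alt_relations q) \<Longrightarrow> subst (alt_to_compact q) p \<in> rel_ideal (U_relations q)"
    by blast
  have "rel_ideal (U_relations q) \<subseteq> {p. subst compact_to_alt p \<in> rel_ideal (alt_relations q)}"
    by (rule rel_ideal_least[OF two_sided_subst_vimage[OF two_sided_rel_ideal]])
      (simp add: compact_to_alt_relations del: subst_diff)
  moreover assume "subst (alt_to_compact q) p \<in> rel_ideal (U_relations q)"
  ultimately have "subst compact_to_alt (subst (alt_to_compact q) p) \<in> rel_ideal (alt_relations q)"
    by blast
  from two_sided_diff[OF two_sided_rel_ideal this alt_compact_alt[of p]]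
  show "p \<in> rel_ideal (alt_relations q)" by simp
qed

end

section \<open>Transport along a surjective homomorphism\<close>

context
  fixes h :: "('g, 'f::field) falg \<Rightarrow> 'a" and A :: "('f, 'a, 'm) module_scheme"
  assumes h: "h \<in> alg_hom free_alg A" and onto: "h ` carrier free_alg = carrier A"
    and zero: "h 0 = \<zero>\<^bsub>A\<^esub>"
begin

lemma alg_hom_ops:
  "h (x * y) = h x \<otimes>\<^bsub>A\<^esub> h y" "h (x + y) = h x \<oplus>\<^bsub>A\<^esub> h y" "h 1 = \<one>\<^bsub>A\<^esub>"
  "h (c \<odot>\<^bsub>free_alg\<^esub> x) = c \<odot>\<^bsub>A\<^esub> h x"
  using h by (simp_all add: alg_hom_def ring_hom_def)

text \<open>\<open>has_presentation\<close> does not ask that the target be a ring; the structure is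
  inherited through \<open>h\<close>. The fact \<open>zero\<close> identifies its zero, on which
  \<open>ring_hom\<close> is silent.\<close>

lemma ring_image: "ring A"
proof -
  have "ring (A \<lparr>carrier := h ` carrier free_alg, zero := h \<zero>\<^bsub>free_alg\<^esub>\<rparr>)"
    using h by (intro ring.ring_hom_imp_img_ring[OF ring_free_alg]) (simp add: alg_hom_def)
  then show ?thesis by (simp only: onto falg_ops(5) zero) simp
qed

lemma alg_hom_diff: "h (x - y) = h x \<ominus>\<^bsub>A\<^esub> h y"
proof -
  interpret ring A by (rule ring_image)
  have closed: "h x \<in> carrier A" for x
    using onto by auto
  have "h (- y) = \<ominus>\<^bsub>A\<^esub> h y"
    using alg_hom_ops(2)[of "- y" y] zero closed by (intro minus_equality[symmetric]) simp_all
  then show ?thesis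
    using alg_hom_ops(2)[of x "- y"] by (simp add: a_minus_def)
qed

lemma alg_hom_comm: "h (comm free_alg x y) = comm A (h x) (h y)"
  and alg_hom_qcomm: "h (qcomm free_alg q x y) = qcomm A q (h x) (h y)"
  by (simp_all add: comm_def qcomm_def alg_hom_ops alg_hom_diff)

lemma alg_hom_from0: "h (from0 free_alg f k) = from0 A (\<lambda>k. h (f k)) k"
  by (simp add: from0_def alg_hom_ops split: nat.split)

end

theorem theorem6p2:
  fixes q :: "'f::field"
  assumes "q \<noteq> 0"
    and "\<And>n::nat. n > 0 \<Longrightarrow> q ^ n \<noteq> 1"
  shows "has_presentation (U q) (alternating_element q) (alt_relations q)"
proof -
  have q: "generic q"
    using assms by (simp add: generic_def)
  obtain h where h: "h \<in> alg_hom free_alg (U q)" and gen: "\<And>x. h (gen x) = U_gen q x"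
    and onto: "h ` carrier free_alg = carrier (U q)"
    and ker: "a_kernel free_alg (U q) h = rel_ideal (U_relations q)"
    using U_has_presentation[of q] unfolding has_presentation_def by blast
  have ker_iff: "h p = \<zero>\<^bsub>U q\<^esub> \<longleftrightarrow> p \<in> rel_ideal (U_relations q)" for p
    using ker by (auto simp: a_kernel_def')
  then have zero: "h 0 = \<zero>\<^bsub>U q\<^esub>"
    using two_sided_0[OF two_sided_rel_ideal] by blast
  note hom = alg_hom_ops[OF h onto zero] alg_hom_comm[OF h onto zero] alg_hom_qcomm[OF h onto zero]
    alg_hom_from0[OF h onto zero]
  have Gt: "h (free_Gt k) = U_Gt q k" for k
    by (simp add: free_Gt_def U_Gt_def hom gen)
  have Wn: "h (free_Wn q k) = U_Wn q k" and Wp: "h (free_Wp q k) = U_Wp q k" for k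
    by (simp_all add: free_Wn_def U_Wn_def free_Wp_def U_Wp_def hom gen Gt)
  have G: "h (free_G q k) = U_G q k" for k
    by (simp add: free_G_def U_G_def hom gen Gt Wn)
  \<comment> \<open>From the free algebra on the alternating generators to that on the compact ones,
    and then to \<open>U q\<close>.\<close>
  let ?h = "\<lambda>p. h (subst (alt_to_compact q) p)"
  have "?h \<in> alg_hom free_alg (U q)"
    using h by (auto simp: alg_hom_def ring_hom_def subst_falg_ops)
  moreover have "?h (gen x) = alternating_element q x" for x
    by (cases x) (simp_all add: Wn Wp G Gt)
  moreover have "?h ` carrier free_alg = carrier (U q)"
  proof -
    have "range ?h = h ` range (subst (alt_to_compact q))"
      by (simp only: image_image)
    \<comment> \<open>\<open>subst compact_to_alt\<close> is a right inverse.\<close>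
    also have "range (subst (alt_to_compact q)) = (UNIV :: (compact_gen, 'f) falg set)"
      using compact_alt_compact[OF q] by (rule surjI)
    finally show ?thesis using onto by simp
  qed
  moreover have "a_kernel free_alg (U q) ?h = rel_ideal (alt_relations q)"
    by (auto simp: a_kernel_def' ker_iff subst_alt_mem_iff[OF q])
  ultimately show ?thesis
    unfolding has_presentation_def by (intro bexI[of _ ?h] conjI allI)
qed

end
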